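(* Let $T:X\to X$ and its inverse $T^{-1}:X\to X$ be piecewise diffeomorphisms of a compact manifold $X$. Suppose given: (1) a fibration $\eta:X\to\Theta$ whose base $\Theta$ is a compact manifold and whose fibers $R_\theta=\eta^{-1}(\theta)$ are compact submanifolds with $\dim R_\theta=\dim X-\dim\Theta$; (2) a closed submanifold $Y\subset X$ with $\dim Y=\dim\Theta$ such that for every integer $k\ge 0$ the manifold $T^{-k}(Y)$ is transversal to all fibers $R_\theta$. Let $d\theta$, $dy$ be finite Lebesgue-class measures on $\Theta$, $Y$ respectively. Then for every $k\in\mathbb N=\{0,1,2,\dots\}$ there is a function $r_k\ge 0$ on $Y$, determined by the data (1) and (2) (and the fixed measures) alone, such that for every continuous non-negative weight function $w$ on $X\times\mathbb N$, with the weighted counting function $$g(\theta;w)=\sum_{(x,k)\in\Gamma(\theta)}w(x,k),\qquad \Gamma(\theta)=\{(x,k):x\in R_\theta,\ k\in\mathbb N,\ T^k(x)\in Y\},$$ one has $$\int_\Theta g(\theta;w)\,d\theta=\int_Y\Big\{\sum_{k\in\mathbb N}w(T^{-k}y,k)\,r_k(y)\Big\}\,dy .$$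
   Context: "Manifold" means a compact manifold, possibly with boundary, corners and singular points. $T$ and $T^{-1}$ are mutually inverse maps that are diffeomorphisms off a singular set; all expressions involving iterates $T^{k}$, $T^{-k}$ refer to the points where these iterates are defined and regular (points of $Y$ where $T^{-k}$ is not defined do not contribute to the right-hand side). A Lebesgue-class measure is one that is mutually absolutely continuous with Lebesgue (smooth) measure. *)

theory Defs
  imports "HOL-Analysis.Analysis"
begin

text \<open>
  Manifolds are subsets of a Euclidean space, which is no restriction by Whitney's embedding
  theorem; smoothness class is C1.  A map on an arbitrary subset of a Euclidean space is C1 if
  near each point it is the restriction of a C1 map defined on an open set.
\<close>

definition C1_on :: "'a::euclidean_space set \<Rightarrow> ('a \<Rightarrow> 'b::euclidean_space) \<Rightarrow> bool" where
  "C1_on S f \<longleftrightarrow>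
     (\<forall>p\<in>S. \<exists>W F F'. open W \<and> p \<in> W \<and>
        (\<forall>x\<in>W. (F has_derivative blinfun_apply (F' x)) (at x)) \<and>
        continuous_on W F' \<and> (\<forall>x\<in>W \<inter> S. F x = f x))"

definition diffeomorphism ::
  "'a::euclidean_space set \<Rightarrow> 'b::euclidean_space set \<Rightarrow> ('a \<Rightarrow> 'b) \<Rightarrow> ('b \<Rightarrow> 'a) \<Rightarrow> bool" where
  "diffeomorphism S S' f g \<longleftrightarrow> homeomorphism S S' f g \<and> C1_on S f \<and> C1_on S' g"

text \<open>
  For \<open>B \<subseteq> A \<subseteq> Basis\<close> this is a copy of \<open>[0,\<infinity>)\<^sup>j \<times> \<real>\<^sup>d\<^sup>-\<^sup>j\<close> with
  \<open>d = card A\<close> and \<open>j = card B\<close>: the local model of a \<open>d\<close>-dimensional manifold with corners.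
  A manifold embedded in \<open>'a\<close> has dimension at most \<open>DIM('a)\<close>, so \<open>'a\<close> itself
  has room for the model.
\<close>

definition corner_model :: "'a::euclidean_space set \<Rightarrow> 'a set \<Rightarrow> 'a set" where
  "corner_model A B = {x. (\<forall>b\<in>Basis - A. x \<bullet> b = 0) \<and> (\<forall>b\<in>B. x \<bullet> b \<ge> 0)}"

definition is_chart ::
  "nat \<Rightarrow> 'a::euclidean_space set \<Rightarrow> 'a set \<Rightarrow> 'a set \<Rightarrow> 'a set \<Rightarrow> ('a \<Rightarrow> 'a) \<Rightarrow> bool" where
  "is_chart d M A B U \<phi> \<longleftrightarrow>
     B \<subseteq> A \<and> A \<subseteq> Basis \<and> card A = d \<and>
     openin (top_of_set M) U \<and>
     openin (top_of_set (corner_model A B)) (\<phi> ` U) \<and>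
     (\<exists>\<psi>. diffeomorphism U (\<phi> ` U) \<phi> \<psi>)"

definition regular_points :: "nat \<Rightarrow> 'a::euclidean_space set \<Rightarrow> 'a set" where
  "regular_points d M = {p. \<exists>A B U \<phi>. is_chart d M A B U \<phi> \<and> p \<in> U}"

text \<open>A set \<open>M\<close> with \<open>regular_points e M = M\<close> is an \<open>e\<close>-dimensional manifold with
  boundary and corners but without singular points.\<close>

definition lower_dimensional :: "nat \<Rightarrow> 'a::euclidean_space set \<Rightarrow> bool" where
  "lower_dimensional d N \<longleftrightarrow>
     (\<exists>\<M>. countable \<M> \<and> N \<subseteq> \<Union>\<M> \<and> (\<forall>M\<in>\<M>. \<exists>e<d. regular_points e M = M))"

text \<open>Compact manifold of dimension \<open>d\<close>, possibly with boundary, corners and singular points.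
  Density of the regular points is what makes \<open>d\<close> the dimension of \<open>M\<close>.\<close>

definition compact_manifold :: "nat \<Rightarrow> 'a::euclidean_space set \<Rightarrow> bool" where
  "compact_manifold d M \<longleftrightarrow>
     compact M \<and> M \<subseteq> closure (regular_points d M) \<and>
     lower_dimensional d (M - regular_points d M)"

text \<open>Span of the velocities at \<open>x\<close> of curves in \<open>M\<close> starting at \<open>x\<close>.  At a regular point, this
  is the full tangent space, also on the boundary and at corners (where the velocities alone only
  form a cone).\<close>

definition tangent_space :: "'a::euclidean_space set \<Rightarrow> 'a \<Rightarrow> 'a set" where
  "tangent_space M x =
     span {v. \<exists>\<gamma>::real \<Rightarrow> 'a. \<gamma> 0 = x \<and> \<gamma> ` {0..1} \<subseteq> M \<and>
                (\<gamma> has_vector_derivative v) (at 0 within {0..1})}"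

text \<open>Transversality in an \<open>n\<close>-dimensional \<open>X\<close> of submanifolds \<open>P\<close>, \<open>Q\<close> of dimensions
  \<open>p\<close>, \<open>q\<close>; the condition is void at singular points.\<close>

definition transversal ::
  "nat \<Rightarrow> 'a::euclidean_space set \<Rightarrow> nat \<Rightarrow> 'a set \<Rightarrow> nat \<Rightarrow> 'a set \<Rightarrow> bool" where
  "transversal n X p P q Q \<longleftrightarrow>
     (\<forall>x \<in> regular_points n X \<inter> regular_points p P \<inter> regular_points q Q.
        {u + v | u v. u \<in> tangent_space P x \<and> v \<in> tangent_space Q x} = tangent_space X x)"

text \<open>
  \<open>\<Sigma>\<close> and \<open>\<Sigma>'\<close> are the singular sets of \<open>T\<close> and of its inverse \<open>T'\<close>.  The values of the total
  functions \<open>T\<close> and \<open>T'\<close> on these sets are arbitrary and never used.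
\<close>

definition piecewise_diffeo ::
  "'a::euclidean_space set \<Rightarrow> ('a \<Rightarrow> 'a) \<Rightarrow> 'a set \<Rightarrow> ('a \<Rightarrow> 'a) \<Rightarrow> 'a set \<Rightarrow> bool" where
  "piecewise_diffeo X T \<Sigma> T' \<Sigma>' \<longleftrightarrow>
     \<Sigma> \<subseteq> X \<and> closed \<Sigma> \<and> X \<subseteq> closure (X - \<Sigma>) \<and>
     \<Sigma>' \<subseteq> X \<and> closed \<Sigma>' \<and> X \<subseteq> closure (X - \<Sigma>') \<and>
     diffeomorphism (X - \<Sigma>) (X - \<Sigma>') T T'"

text \<open>The points of \<open>X\<close> at which the \<open>k\<close>-th iterate is defined and regular.\<close>

definition regular_iterate_dom :: "'a set \<Rightarrow> ('a \<Rightarrow> 'a) \<Rightarrow> 'a set \<Rightarrow> nat \<Rightarrow> 'a set" where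
  "regular_iterate_dom X T \<Sigma> k = {x \<in> X. \<forall>i<k. (T ^^ i) x \<in> X - \<Sigma>}"

text \<open>For a diffeomorphism off singular sets this is \<open>T\<^sup>-\<^sup>k(Y)\<close>.\<close>

definition iterate_preimage ::
  "'a set \<Rightarrow> ('a \<Rightarrow> 'a) \<Rightarrow> 'a set \<Rightarrow> nat \<Rightarrow> 'a set \<Rightarrow> 'a set" where
  "iterate_preimage X T \<Sigma> k Y = {x \<in> regular_iterate_dom X T \<Sigma> k. (T ^^ k) x \<in> Y}"

definition fiber :: "'a set \<Rightarrow> ('a \<Rightarrow> 'b) \<Rightarrow> 'b \<Rightarrow> 'a set" where
  "fiber X \<eta> \<theta> = {x \<in> X. \<eta> x = \<theta>}"

text \<open>
  A C1 map of \<open>X\<close> onto a compact manifold \<open>\<Theta>\<close> that is a submersion off the singular points and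
  whose fibers are compact submanifolds of complementary dimension.  C1 fiber bundles are
  instances; local triviality is not required, since with boundary and corners the topology of the
  fiber may change with \<open>\<theta>\<close>.
  Although \<open>D\<close> is not unique on the whole space, its values on \<open>tangent_space X x\<close> are.
\<close>

definition fibration ::
  "nat \<Rightarrow> 'a::euclidean_space set \<Rightarrow> nat \<Rightarrow> 'b::euclidean_space set \<Rightarrow> ('a \<Rightarrow> 'b) \<Rightarrow> bool" where
  "fibration n X m \<Theta> \<eta> \<longleftrightarrow>
     compact_manifold m \<Theta> \<and> m \<le> n \<and> C1_on X \<eta> \<and> \<eta> ` X = \<Theta> \<and>
     (\<forall>x \<in> regular_points n X. \<eta> x \<in> regular_points m \<Theta> \<longrightarrow>
        (\<exists>D. (\<eta> has_derivative D) (at x within X) \<and>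
             D ` tangent_space X x = tangent_space \<Theta> (\<eta> x))) \<and>
     (\<forall>\<theta>\<in>\<Theta>. compact_manifold (n - m) (fiber X \<eta> \<theta>))"

text \<open>
  A subset of a \<open>d\<close>-dimensional manifold is Lebesgue null if its image in every chart is.  An
  image \<open>N \<subseteq> span A\<close> is null for the \<open>card A\<close>-dimensional Lebesgue measure on \<open>span A\<close> iff the
  cylinder over it, i.e. its preimage under the orthogonal projection onto \<open>span A\<close>, is null
  in the whole space (for \<open>A = {}\<close>: iff \<open>N\<close> is empty).  Singular points lie in no chart
  and hence form a null set.
\<close>

definition lebesgue_null :: "nat \<Rightarrow> 'a::euclidean_space set \<Rightarrow> 'a set \<Rightarrow> bool" where
  "lebesgue_null d M N \<longleftrightarrow>
     (\<forall>A B U \<phi>. is_chart d M A B U \<phi> \<longrightarrow>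
        negligible {x. (\<Sum>b\<in>A. (x \<bullet> b) *\<^sub>R b) \<in> \<phi> ` (N \<inter> U)})"

definition lebesgue_class :: "nat \<Rightarrow> 'a::euclidean_space set \<Rightarrow> 'a measure \<Rightarrow> bool" where
  "lebesgue_class d M \<mu> \<longleftrightarrow>
     sets \<mu> = sets (restrict_space borel M) \<and>
     (\<forall>N\<in>sets \<mu>. emeasure \<mu> N = 0 \<longleftrightarrow> lebesgue_null d M N)"

definition Gamma ::
  "'a set \<Rightarrow> ('a \<Rightarrow> 'a) \<Rightarrow> 'a set \<Rightarrow> 'a set \<Rightarrow> ('a \<Rightarrow> 'b) \<Rightarrow> 'b \<Rightarrow> ('a \<times> nat) set" where
  "Gamma X T \<Sigma> Y \<eta> \<theta> = {(x, k). x \<in> fiber X \<eta> \<theta> \<and> x \<in> iterate_preimage X T \<Sigma> k Y}"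

definition weighted_count ::
  "'a set \<Rightarrow> ('a \<Rightarrow> 'a) \<Rightarrow> 'a set \<Rightarrow> 'a set \<Rightarrow> ('a \<Rightarrow> 'b) \<Rightarrow> ('a \<times> nat \<Rightarrow> real) \<Rightarrow> 'b \<Rightarrow> ennreal" where
  "weighted_count X T \<Sigma> Y \<eta> w \<theta> =
     (\<Sum>\<^sub>\<infinity>(x, k)\<in>Gamma X T \<Sigma> Y \<eta> \<theta>. ennreal (w (x, k)))"

end

theory Submission
  imports Defs
begin

text \<open>
  Through \<open>y = T\<^sup>k x\<close> the points of \<open>\<Gamma>(\<theta>)\<close> at time \<open>k\<close> are the points of the fiber over \<open>\<theta>\<close> of
  \<open>g\<^sub>k = \<eta> \<circ> T\<^sup>-\<^sup>k\<close>, a locally Lipschitz map from an open subset of \<open>Y\<close> to \<open>\<Theta>\<close>.  The measure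
  \<open>\<lambda>\<^sub>k(E) = \<integral> card (E \<inter> g\<^sub>k\<^sup>-\<^sup>1(\<theta>)) d\<theta>\<close> on \<open>Y\<close> satisfies
  \<open>\<integral> (\<Sum>y \<in> g\<^sub>k\<^sup>-\<^sup>1(\<theta>). h y) d\<theta> = \<integral> h d\<lambda>\<^sub>k\<close>.  Since \<open>dim Y = dim \<Theta>\<close>, the map \<open>g\<^sub>k\<close> takes null sets
  to null sets, so \<open>\<lambda>\<^sub>k\<close> is absolutely continuous, and locally almost all fibers of \<open>g\<^sub>k\<close> are finite,
  so \<open>\<lambda>\<^sub>k\<close> is sigma-finite.  Its Radon-Nikodym derivative is \<open>r\<^sub>k\<close>.
\<close>

text \<open>The main obstacle is measurability. A continuous image of a Borel set need not be Borel,
  so neither the number of points of a Borel set \<open>E\<close> in a fiber nor the image of a null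
  set is measurable a priori. For F-sigma sets there is no such difficulty, because Euclidean spaces
  are sigma-compact. A finite measure exhausts every Borel set by an F-sigma set up to a null set,
  and almost every fiber misses that null set; so counts over Borel sets agree almost everywhere
  with measurable functions, and the integral identities are proved for these representatives.
  Singular points of \<open>Y\<close> have measure zero by convention, which says nothing about
  their images. They are controlled by dimension: they lie in countably many pieces of dimension
  below that of \<Theta>, and locally Lipschitz images of such pieces are null. Each density is
  fixed before a weight is chosen, so it depends on the geometric data and the measures
  alone.\<close>

section \<open>Locally Lipschitz maps\<close>

text \<open>Only the relative neighborhood in \<open>S\<close> enters, so the notion survives
  restriction to arbitrary subsets, including corners and singular points, where no derivative along
  \<open>S\<close> need be determined.\<close>

definition locally_Lipschitz_on :: "'a::metric_space set \<Rightarrow> ('a \<Rightarrow> 'b::metric_space) \<Rightarrow> bool" where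
  "locally_Lipschitz_on S f \<longleftrightarrow> (\<forall>x\<in>S. \<exists>W B. open W \<and> x \<in> W \<and> B-lipschitz_on (W \<inter> S) f)"

lemma locally_Lipschitz_on_subset:
  "locally_Lipschitz_on S f \<Longrightarrow> R \<subseteq> S \<Longrightarrow> locally_Lipschitz_on R f"
  unfolding locally_Lipschitz_on_def
  by (meson Int_mono lipschitz_on_subset order_refl subsetD)

lemma locally_Lipschitz_on_imp_continuous_on:
  assumes "locally_Lipschitz_on S f"
  shows "continuous_on S f"
  unfolding continuous_on_eq_continuous_within
proof
  fix x assume x: "x \<in> S"
  then obtain W B where W: "open W" "x \<in> W" "B-lipschitz_on (W \<inter> S) f"
    using assms unfolding locally_Lipschitz_on_def by blast
  have "continuous (at x within S \<inter> W) f"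
    using lipschitz_on_continuous_on[OF W(3)] W(2) x
    by (simp add: continuous_on_eq_continuous_within Int_commute)
  moreover have "at x within S \<inter> W = at x within S"
    by (rule at_within_nhd[OF W(2,1)]) auto
  ultimately show "continuous (at x within S) f"
    by (simp add: continuous_within)
qed

lemma locally_Lipschitz_on_compose:
  assumes f: "locally_Lipschitz_on S f" and g: "locally_Lipschitz_on R g" and "f ` S \<subseteq> R"
  shows "locally_Lipschitz_on S (\<lambda>x. g (f x))"
  unfolding locally_Lipschitz_on_def
proof
  fix x assume x: "x \<in> S"
  then obtain W B where W: "open W" "x \<in> W" "B-lipschitz_on (W \<inter> S) f"
    using f unfolding locally_Lipschitz_on_def by blast
  obtain V C where V: "open V" "f x \<in> V" "C-lipschitz_on (V \<inter> R) g"
    using g x assms(3) unfolding locally_Lipschitz_on_def by blast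
  obtain U where U: "open U" "U \<inter> S = f -` V \<inter> S"
    using locally_Lipschitz_on_imp_continuous_on[OF f] V(1)
    by (auto simp: continuous_on_open_invariant)
  have "(C * B)-lipschitz_on (W \<inter> U \<inter> S) (g \<circ> f)"
  proof (rule lipschitz_on_compose)
    show "B-lipschitz_on (W \<inter> U \<inter> S) f" using W(3) by (rule lipschitz_on_subset) auto
    show "C-lipschitz_on (f ` (W \<inter> U \<inter> S)) g"
      using V(3) by (rule lipschitz_on_subset) (use U(2) assms(3) in auto)
  qed
  moreover have "x \<in> W \<inter> U" using U(2) V(2) W(2) x by auto
  ultimately show "\<exists>W B. open W \<and> x \<in> W \<and> B-lipschitz_on (W \<inter> S) (\<lambda>x. g (f x))"
    using W(1) U(1) by (metis (no_types, lifting) comp_apply lipschitz_on_def open_Int)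
qed

lemma locally_Lipschitz_on_Pair:
  assumes "locally_Lipschitz_on S f" "locally_Lipschitz_on S g"
  shows "locally_Lipschitz_on S (\<lambda>x. (f x, g x))"
  unfolding locally_Lipschitz_on_def
proof
  fix x assume x: "x \<in> S"
  then obtain W B where W: "open W" "x \<in> W" "B-lipschitz_on (W \<inter> S) f"
    using assms(1) unfolding locally_Lipschitz_on_def by blast
  obtain V C where V: "open V" "x \<in> V" "C-lipschitz_on (V \<inter> S) g"
    using assms(2) x unfolding locally_Lipschitz_on_def by blast
  have "(sqrt (B\<^sup>2 + C\<^sup>2))-lipschitz_on (W \<inter> V \<inter> S) (\<lambda>x. (f x, g x))"
    by (rule lipschitz_on_Pair) (rule lipschitz_on_subset[OF W(3)] lipschitz_on_subset[OF V(3)]; auto)+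
  then show "\<exists>W B. open W \<and> x \<in> W \<and> B-lipschitz_on (W \<inter> S) (\<lambda>x. (f x, g x))"
    using W V by (meson IntI open_Int)
qed

lemma bounded_linear_imp_locally_Lipschitz_on:
  assumes "bounded_linear f"
  shows "locally_Lipschitz_on S f"
proof -
  obtain K where "0 \<le> K" "\<And>x. norm (f x) \<le> norm x * K"
    using bounded_linear.nonneg_bounded[OF assms] by blast
  then have "K-lipschitz_on (UNIV \<inter> S) f"
    unfolding lipschitz_on_def dist_norm
    by (metis assms bounded_linear.linear linear_diff mult.commute)
  then show ?thesis unfolding locally_Lipschitz_on_def by (meson UNIV_I open_UNIV)
qed

text \<open>The mean value inequality needs a convex domain, which \<open>S\<close> need not
  provide. It is applied to the local extension \<open>F\<close> on a ball where \<open>F'\<close>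
  stays within distance 1 of \<open>F' p\<close>.\<close>

lemma C1_on_imp_locally_Lipschitz_on:
  assumes "C1_on S f"
  shows "locally_Lipschitz_on S f"
  unfolding locally_Lipschitz_on_def
proof
  fix p assume p: "p \<in> S"
  obtain W F F' where W: "open W" "p \<in> W"
    and der: "\<And>x. x \<in> W \<Longrightarrow> (F has_derivative blinfun_apply (F' x)) (at x)"
    and cont: "continuous_on W F'" and eq: "\<And>x. x \<in> W \<inter> S \<Longrightarrow> F x = f x"
    using assms[unfolded C1_on_def, rule_format, OF p] by blast
  have "isCont F' p" using cont W by (simp add: continuous_on_eq_continuous_at)
  then obtain d where d: "d > 0" "\<And>x. dist x p < d \<Longrightarrow> dist (F' x) (F' p) < 1"
    unfolding continuous_at_eps_delta by (metis zero_less_one)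
  obtain e where e: "e > 0" "ball p e \<subseteq> W" using W open_contains_ball by metis
  define V where "V = ball p (min d e)"
  have VW: "V \<subseteq> W" using e by (auto simp: V_def)
  have onorm: "onorm (blinfun_apply (F' x)) \<le> norm (F' p) + 1" if "x \<in> V" for x
  proof -
    have "dist (F' x) (F' p) < 1" using that d(2)[of x] by (simp add: V_def dist_commute)
    then have "norm (F' x) \<le> norm (F' p) + 1"
      by (smt (verit) dist_norm norm_triangle_ineq2)
    then show ?thesis by (simp add: norm_blinfun.rep_eq)
  qed
  have "norm (F x - F y) \<le> (norm (F' p) + 1) * norm (x - y)" if "x \<in> V" "y \<in> V" for x y
  proof (rule differentiable_bound[OF _ _ onorm that])
    show "convex V" by (simp add: V_def)
    show "(F has_derivative blinfun_apply (F' z)) (at z within V)" if "z \<in> V" for z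
      using der VW that by (meson has_derivative_at_withinI subsetD)
  qed
  then have "(norm (F' p) + 1)-lipschitz_on (V \<inter> S) F"
    unfolding lipschitz_on_def dist_norm by simp
  then have "(norm (F' p) + 1)-lipschitz_on (V \<inter> S) f"
    using eq VW unfolding lipschitz_on_def by (metis Int_iff subsetD)
  moreover have "open V" "p \<in> V" using d(1) e(1) by (auto simp: V_def)
  ultimately show "\<exists>W B. open W \<and> p \<in> W \<and> B-lipschitz_on (W \<inter> S) f" by blast
qed

section \<open>Cylinders over lower-dimensional sets\<close>

text \<open>For \<open>A\<close> inside \<open>Basis\<close> this is the orthogonal projection onto
  the span of \<open>A\<close>; its preimages are the cylinders that occur in
  \<open>lebesgue_null\<close>.\<close>

definition coord_proj :: "'a::euclidean_space set \<Rightarrow> 'a \<Rightarrow> 'a" where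
  "coord_proj A x = (\<Sum>b\<in>A. (x \<bullet> b) *\<^sub>R b)"

lemma bounded_linear_coord_proj: "bounded_linear (coord_proj A)"
  unfolding coord_proj_def
  by (intro bounded_linear_sum bounded_linear_scaleR_left[THEN bounded_linear_compose] bounded_linear_inner_left)

lemma coord_proj_inner:
  assumes "A \<subseteq> Basis" "b \<in> Basis"
  shows "coord_proj A x \<bullet> b = (if b \<in> A then x \<bullet> b else 0)"
proof -
  have "finite A" using assms(1) finite_Basis finite_subset by blast
  have "coord_proj A x \<bullet> b = (\<Sum>a\<in>A. if a = b then x \<bullet> b else 0)"
    unfolding coord_proj_def inner_sum_left
    by (intro sum.cong refl) (use assms in \<open>auto simp: inner_Basis subset_iff\<close>)
  also have "\<dots> = (if b \<in> A then x \<bullet> b else 0)"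
    using \<open>finite A\<close> by (simp add: sum.delta)
  finally show ?thesis .
qed

lemma coord_proj_eq_self:
  assumes "A \<subseteq> Basis" "\<And>b. b \<in> Basis - A \<Longrightarrow> x \<bullet> b = 0"
  shows "coord_proj A x = x"
  by (rule euclidean_eqI) (use assms in \<open>auto simp: coord_proj_inner\<close>)

lemma corner_model_coord_proj:
  assumes "A \<subseteq> Basis" "x \<in> corner_model A B"
  shows "coord_proj A x = x"
  by (rule coord_proj_eq_self) (use assms in \<open>auto simp: corner_model_def\<close>)

text \<open>\<open>negligible\<close> refers to the completed measure, whereas products and sections
  are handled for Borel sets.\<close>

lemma negligible_Borel_hull:
  fixes S :: "'a::euclidean_space set"
  assumes "negligible S"
  obtains G where "G \<in> null_sets lborel" "S \<subseteq> G"
proof -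
  have "S \<in> null_sets (completion lborel)" using assms by (simp add: negligible_iff_null_sets)
  then show ?thesis using that by (auto simp: null_sets_completion_iff2)
qed

lemma negligible_Times_UNIV:
  fixes S :: "'a::euclidean_space set"
  assumes "negligible S"
  shows "negligible (S \<times> (UNIV :: 'b::euclidean_space set))"
proof -
  obtain G where G: "G \<in> null_sets lborel" "S \<subseteq> G" by (rule negligible_Borel_hull[OF assms])
  have "G \<times> (UNIV::'b set) \<in> null_sets (lborel \<Otimes>\<^sub>M lborel)"
    by (rule lborel.times_in_null_sets1) (use G in auto)
  then have "negligible (G \<times> (UNIV::'b set))"
    unfolding negligible_iff_null_sets lborel_prod by (rule null_sets_completionI)
  then show ?thesis by (rule negligible_subset) (use G(2) in auto)
qed

text \<open>By Fubini almost every section of a Borel hull is null. Lebesgue measure is not zero, so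
  at least one such section exists, and every section contains \<open>S\<close>.\<close>

lemma negligible_UNIV_TimesD:
  fixes S :: "'b::euclidean_space set"
  assumes "negligible ((UNIV :: 'a::euclidean_space set) \<times> S)"
  shows "negligible S"
proof -
  obtain G where G: "G \<in> null_sets lborel" "(UNIV :: 'a set) \<times> S \<subseteq> G"
    by (rule negligible_Borel_hull[OF assms])
  have "AE z in lborel \<Otimes>\<^sub>M lborel. z \<notin> G"
    using G(1) unfolding lborel_prod by (rule AE_not_in)
  then have "AE x in lborel. AE y in lborel. (x::'a, y::'b) \<notin> G"
    by (rule lborel_pair.AE_pair)
  moreover have "ae_filter (lborel :: 'a measure) \<noteq> bot"
    by (simp add: ae_filter_eq_bot_iff)
  ultimately obtain x where "AE y in lborel. (x::'a, y::'b) \<notin> G"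
    using eventually_happens' by blast
  then have "AE y in lebesgue. (x, y) \<notin> G" by (rule AE_completion)
  then have "{y. (x, y) \<in> G} \<in> null_sets lebesgue"
    by (auto simp: eventually_ae_filter intro: completion.complete2)
  then have "negligible {y. (x, y) \<in> G}" by (simp add: negligible_iff_null_sets)
  then show ?thesis by (rule negligible_subset) (use G(2) in auto)
qed

text \<open>The source cylinder lives in \<open>'a\<close>, the target cylinder in \<open>'b\<close>, so neither dimension need be
  at most the other.  In \<open>'a \<times> 'b\<close> one map \<open>G\<close> exchanges the coordinates in \<open>A\<close> with their copies
  in \<open>A'\<close> while applying \<open>h\<close>.\<close>

lemma negligible_cylinder_image:
  fixes S :: "'a::euclidean_space set" and h :: "'a \<Rightarrow> 'b::euclidean_space"
  assumes A: "A \<subseteq> Basis" and A': "A' \<subseteq> Basis"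
    and S: "\<And>s. s \<in> S \<Longrightarrow> coord_proj A s = s"
    and h: "locally_Lipschitz_on S h"
    and dim: "card A < card A' \<or> card A = card A' \<and> negligible {x. coord_proj A x \<in> S}"
  shows "negligible {v. coord_proj A' v \<in> h ` S}"
proof -
  have fin: "finite A" "finite A'" using A A' finite_Basis finite_subset by blast+
  obtain i where i: "i ` A \<subseteq> A'" "inj_on i A"
    using card_le_inj[OF fin] dim by fastforce
  define J where "J z = (\<Sum>a\<in>A. (z \<bullet> i a) *\<^sub>R a)" for z :: 'b
  define I where "I u = (\<Sum>a\<in>A. (u \<bullet> a) *\<^sub>R i a)" for u :: 'a
  \<comment> \<open>The hypothesis \<open>dim\<close> makes \<open>D\<close> null in either case: if
    \<open>card A < card A'\<close>, some coordinate in \<open>A' - i\<close> is missed by the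
    injection and \<open>D\<close> lies in a hyperplane; otherwise \<open>D\<close> lies in a
    product with the null cylinder over \<open>S\<close>.\<close>
  define D where "D = {w :: 'a \<times> 'b. coord_proj A (fst w) \<in> S \<and> (\<forall>b\<in>A' - i ` A. snd w \<bullet> b = 0)}"
  \<comment> \<open>For \<open>w = (x, z)\<close>: the first component is \<open>x\<close> with its
    \<open>A\<close>-coordinates replaced by those of \<open>z\<close> along \<open>i\<close>; the
    second is \<open>z\<close> with its \<open>A'\<close>-part replaced by the value of
    \<open>h\<close> when that value lies in the span of \<open>A'\<close>, as it does at the points
    hit below.\<close>
  define G where "G w = (fst w - coord_proj A (fst w) + J (snd w),
    h (coord_proj A (fst w)) + (snd w - coord_proj A' (snd w)))" for w
  have "negligible D"
    using dim
  proof
    assume "card A < card A'"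
    then have "i ` A \<noteq> A'" using card_image[OF i(2)] by auto
    then obtain b where b: "b \<in> A'" "b \<notin> i ` A" using i(1) by auto
    have "b \<in> Basis" using b A' by auto
    then have "negligible {w :: 'a \<times> 'b. (0, b) \<bullet> w = 0}"
      by (intro negligible_hyperplane) (auto simp: zero_prod_def)
    moreover have "D \<subseteq> {w. (0, b) \<bullet> w = 0}"
      using b by (auto simp: D_def inner_prod_def inner_commute)
    ultimately show ?thesis by (rule negligible_subset)
  next
    assume "card A = card A' \<and> negligible {x. coord_proj A x \<in> S}"
    then have "negligible ({x. coord_proj A x \<in> S} \<times> (UNIV :: 'b set))"
      using negligible_Times_UNIV by blast
    then show ?thesis by (rule negligible_subset) (auto simp: D_def)
  qed
  have blP: "bounded_linear (\<lambda>w :: 'a \<times> 'b. coord_proj A (fst w))"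
    by (intro bounded_linear_compose[OF bounded_linear_coord_proj] bounded_linear_fst)
  let ?p = "\<lambda>w :: 'a \<times> 'b. fst w - coord_proj A (fst w) + J (snd w)"
  let ?h = "\<lambda>w :: 'a \<times> 'b. h (coord_proj A (fst w))"
  let ?q = "\<lambda>w :: 'a \<times> 'b. snd w - coord_proj A' (snd w)"
  \<comment> \<open>The second component of \<open>G\<close> is a sum, so \<open>G\<close> is
    obtained as the triple of \<open>?p\<close>, \<open>?h\<close>, \<open>?q\<close> followed by
    the linear map \<open>?s\<close>.\<close>
  let ?s = "\<lambda>p. (fst p, fst (snd p) + snd (snd p)) :: 'a \<times> 'b"
  have h': "locally_Lipschitz_on D ?h"
    by (rule locally_Lipschitz_on_compose[OF bounded_linear_imp_locally_Lipschitz_on[OF blP] h])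
       (auto simp: D_def)
  have "bounded_linear ?p"
    unfolding J_def
    by (intro bounded_linear_add bounded_linear_sub blP bounded_linear_fst bounded_linear_sum
        bounded_linear_scaleR_left[THEN bounded_linear_compose]
        bounded_linear_inner_left[THEN bounded_linear_compose] bounded_linear_snd)
  then have p: "locally_Lipschitz_on D ?p" by (rule bounded_linear_imp_locally_Lipschitz_on)
  have "bounded_linear ?q"
    by (intro bounded_linear_sub bounded_linear_compose[OF bounded_linear_coord_proj] bounded_linear_snd)
  then have q: "locally_Lipschitz_on D ?q" by (rule bounded_linear_imp_locally_Lipschitz_on)
  note T = locally_Lipschitz_on_Pair[OF p locally_Lipschitz_on_Pair[OF h' q]]
  have "bounded_linear ?s"
    by (intro bounded_linear_Pair bounded_linear_add bounded_linear_fst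
        bounded_linear_compose[OF bounded_linear_fst bounded_linear_snd]
        bounded_linear_compose[OF bounded_linear_snd bounded_linear_snd])
  then have "locally_Lipschitz_on UNIV ?s" by (rule bounded_linear_imp_locally_Lipschitz_on)
  from locally_Lipschitz_on_compose[OF T this]
  have lip: "locally_Lipschitz_on D G" by (simp add: G_def[abs_def])
  have "negligible (G ` D)"
  proof (rule negligible_locally_Lipschitz_image[OF order_refl \<open>negligible D\<close>])
    fix x assume "x \<in> D"
    then obtain W B where W: "open W" "x \<in> W" "B-lipschitz_on (W \<inter> D) G"
      using lip unfolding locally_Lipschitz_on_def by blast
    then have "\<forall>y\<in>D \<inter> W. norm (G y - G x) \<le> B * norm (y - x)"
      using \<open>x \<in> D\<close> unfolding lipschitz_on_def dist_norm by simp
    then show "\<exists>T B. open T \<and> x \<in> T \<and> (\<forall>y\<in>D \<inter> T. norm (G y - G x) \<le> B * norm (y - x))"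
      using W by blast
  qed
  moreover have "(UNIV :: 'a set) \<times> {v. coord_proj A' v \<in> h ` S} \<subseteq> G ` D"
  proof
    fix w :: "'a \<times> 'b" assume "w \<in> UNIV \<times> {v. coord_proj A' v \<in> h ` S}"
    then obtain u v s where w: "w = (u, v)" and s: "s \<in> S" "coord_proj A' v = h s" by auto
    \<comment> \<open>The preimage of \<open>(u, v)\<close> under \<open>G\<close>: \<open>s\<close>
      takes the place of the \<open>A\<close>-part of \<open>u\<close>, and the displaced
      coordinates of \<open>u\<close> are stored by \<open>I\<close> in the \<open>A'\<close>-part
      of \<open>z\<close>.\<close>
    define x z where "x = u - coord_proj A u + s" and "z = v - coord_proj A' v + I u"
    have i_Basis: "i a \<in> A'" "i a \<in> Basis" if "a \<in> A" for a using i(1) A' that by auto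
    have I_i: "I u \<bullet> i a = u \<bullet> a" if "a \<in> A" for a
    proof -
      have "I u \<bullet> i a = (\<Sum>a'\<in>A. if a' = a then u \<bullet> a else 0)"
        unfolding I_def inner_sum_left
        by (intro sum.cong refl)
           (use that i_Basis inj_onD[OF i(2)] in \<open>auto simp: inner_Basis\<close>)
      then show ?thesis using that fin(1) by (simp add: sum.delta)
    qed
    have I_0: "I u \<bullet> b = 0" if "b \<in> Basis - i ` A" for b
      unfolding I_def inner_sum_left
      by (intro sum.neutral) (use that i_Basis in \<open>auto simp: inner_Basis\<close>)
    have projI: "coord_proj A' (I u) = I u"
      by (rule coord_proj_eq_self[OF A']) (use I_0 i(1) in auto)
    have idem: "coord_proj C (coord_proj C y) = coord_proj C y" if "C \<subseteq> Basis" for C and y :: "'c::euclidean_space"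
      by (rule coord_proj_eq_self[OF that]) (use that in \<open>simp add: coord_proj_inner\<close>)
    have projx: "coord_proj A x = s"
      unfolding x_def using S[OF s(1)] idem[OF A]
      by (simp add: linear_diff[OF bounded_linear.linear[OF bounded_linear_coord_proj]]
           linear_add[OF bounded_linear.linear[OF bounded_linear_coord_proj]])
    have projz: "coord_proj A' z = I u"
      unfolding z_def using projI idem[OF A']
      by (simp add: linear_diff[OF bounded_linear.linear[OF bounded_linear_coord_proj]]
           linear_add[OF bounded_linear.linear[OF bounded_linear_coord_proj]])
    have "J z = coord_proj A u"
      unfolding J_def coord_proj_def[of A] z_def
      by (intro sum.cong refl)
         (use I_i i_Basis A' in \<open>simp add: inner_add_left inner_diff_left coord_proj_inner\<close>)
    then have "G (x, z) = w"
      unfolding G_def w using projx projz s(2) by (simp add: x_def z_def)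
    moreover have "(x, z) \<in> D"
      using s(1) I_0 coord_proj_inner[OF A'] A'
      by (auto simp: D_def projx z_def inner_add_left inner_diff_left subset_iff)
    ultimately show "w \<in> G ` D" by (metis imageI)
  qed
  ultimately have "negligible ((UNIV :: 'a set) \<times> {v. coord_proj A' v \<in> h ` S})"
    by (rule negligible_subset)
  then show ?thesis by (rule negligible_UNIV_TimesD)
qed

text \<open>Cut \<open>S\<close> into about \<open>N\<^sup>m\<close> cubes of side about \<open>1/N\<close>, where \<open>m = card A\<close>.  Their images have
  measure \<open>O(1/N\<^sup>m)\<close>, so the number of cubes hit by a fiber has bounded integral, uniformly in
  \<open>N\<close>; Fatou's lemma bounds the limit.\<close>

lemma negligible_infinite_fibers:
  fixes S :: "'a::euclidean_space set" and h :: "'a \<Rightarrow> 'b::euclidean_space"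
  assumes A: "A \<subseteq> Basis" and A': "A' \<subseteq> Basis" and card: "card A = card A'"
    and "compact S" and S: "\<And>s. s \<in> S \<Longrightarrow> coord_proj A s = s"
    and h: "L-lipschitz_on S h"
  shows "negligible {v. infinite {s\<in>S. h s = coord_proj A' v}}"
proof -
  have fin: "finite A" "finite A'" using A A' finite_Basis finite_subset by blast+
  have contP: "continuous_on UNIV (coord_proj A' :: 'b \<Rightarrow> 'b)"
    by (rule linear_continuous_on[OF bounded_linear_coord_proj])
  obtain R where R: "R > 0" "\<And>s. s \<in> S \<Longrightarrow> norm s \<le> R"
    using compact_imp_bounded[OF \<open>compact S\<close>] by (auto simp: bounded_pos)
  have L: "L \<ge> 0" using h by (rule lipschitz_on_nonneg)
  define m where "m = card A"
  define C where "C N = (A \<rightarrow>\<^sub>E {..<Suc N})" for N :: nat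
  \<comment> \<open>The coordinates of \<open>S\<close> lie in an interval of length
    \<open>2 * R\<close>, cut into \<open>Suc N\<close> pieces; the successor avoids division by
    zero.\<close>
  define \<delta> where "\<delta> N = 2 * R / real (Suc N)" for N
  have \<delta>: "\<delta> N > 0" for N using R(1) by (simp add: \<delta>_def)
  \<comment> \<open>Closed cells keep the pieces compact, hence their images closed. Cells may share
    faces, which is harmless: only covering and an upper bound for the total measure matter.\<close>
  define Q where "Q N c = {s\<in>S. \<forall>a\<in>A. s \<bullet> a \<in> {- R + \<delta> N * real (c a) .. - R + \<delta> N * real (Suc (c a))}}"
    for N and c :: "'a \<Rightarrow> nat"
  have diam: "norm (s - t) \<le> real m * \<delta> N" if "s \<in> Q N c" "t \<in> Q N c" for s t N c
  proof -
    have st: "s \<in> S" "t \<in> S" using that by (auto simp: Q_def)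
    have "s - t = coord_proj A (s - t)"
      using S st by (simp add: linear_diff[OF bounded_linear.linear[OF bounded_linear_coord_proj]])
    also have "norm \<dots> \<le> (\<Sum>a\<in>A. \<bar>(s - t) \<bullet> a\<bar>)"
      unfolding coord_proj_def
      by (rule order_trans[OF norm_sum]) (use A in \<open>auto intro!: sum_mono\<close>)
    also have "\<dots> \<le> (\<Sum>a\<in>A. \<delta> N)"
    proof (rule sum_mono)
      fix a assume "a \<in> A"
      then have "s \<bullet> a \<in> {- R + \<delta> N * real (c a) .. - R + \<delta> N * real (Suc (c a))}"
        "t \<bullet> a \<in> {- R + \<delta> N * real (c a) .. - R + \<delta> N * real (Suc (c a))}"
        using that by (auto simp: Q_def)
      then show "\<bar>(s - t) \<bullet> a\<bar> \<le> \<delta> N" by (simp add: inner_diff_left algebra_simps abs_le_iff)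
    qed
    finally show ?thesis by (simp add: m_def)
  qed
  have cover: "\<exists>c\<in>C N. s \<in> Q N c" if "s \<in> S" for s N
  proof -
    have *: "\<exists>i<Suc N. s \<bullet> a \<in> {- R + \<delta> N * real i .. - R + \<delta> N * real (Suc i)}" if "a \<in> A" for a
    proof -
      define x where "x = (s \<bullet> a + R) / \<delta> N"
      have "\<bar>s \<bullet> a\<bar> \<le> R"
        using Basis_le_norm[of a s] R(2)[OF \<open>s \<in> S\<close>] that A by auto
      moreover have "real (Suc N) * \<delta> N = 2 * R" by (simp add: \<delta>_def)
      ultimately have x0: "0 \<le> x" and xN: "x \<le> real (Suc N)"
        using \<delta>[of N] by (auto simp: x_def pos_divide_le_eq simp del: of_nat_Suc)
      \<comment> \<open>The minimum matters only at the right end \<open>x = Suc N\<close>, where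
        the floor would leave the index range.\<close>
      define i where "i = min (nat \<lfloor>x\<rfloor>) N"
      have "real i \<le> x" "x \<le> real (Suc i)"
        using x0 xN by (auto simp: i_def min_def) linarith+
      then have "\<delta> N * real i \<le> s \<bullet> a + R" "s \<bullet> a + R \<le> \<delta> N * real (Suc i)"
        using \<delta>[of N] unfolding x_def by (auto simp: field_simps)
      then show ?thesis by (intro exI[of _ i]) (auto simp: i_def)
    qed
    then obtain i where "\<And>a. a \<in> A \<Longrightarrow> i a < Suc N \<and>
        s \<bullet> a \<in> {- R + \<delta> N * real (i a) .. - R + \<delta> N * real (Suc (i a))}" by metis
    then have "restrict i A \<in> C N" "s \<in> Q N (restrict i A)"
      using \<open>s \<in> S\<close> by (auto simp: C_def Q_def)
    then show ?thesis by blast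
  qed
  have compactQ: "compact (Q N c)" for N c
  proof -
    have "closed (\<Inter>a\<in>A. {s. - R + \<delta> N * real (c a) \<le> s \<bullet> a} \<inter> {s. s \<bullet> a \<le> - R + \<delta> N * real (Suc (c a))})"
      by (intro closed_INT closed_Int ballI closed_Collect_le continuous_intros)
    moreover have "Q N c = S \<inter> (\<Inter>a\<in>A. {s. - R + \<delta> N * real (c a) \<le> s \<bullet> a} \<inter> {s. s \<bullet> a \<le> - R + \<delta> N * real (Suc (c a))})"
      by (auto simp: Q_def)
    ultimately show ?thesis using \<open>compact S\<close> by auto
  qed
  \<comment> \<open>Cylinders are unbounded in the directions outside \<open>A'\<close>, so measures
    are taken inside a box, which later grows to the whole space.\<close>
  have "negligible ({v. infinite {s\<in>S. h s = coord_proj A' v}} \<inter> cbox (- M *\<^sub>R One) (M *\<^sub>R One))"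
    if "M > 0" for M :: real
  proof -
    let ?box = "cbox (- M *\<^sub>R One) (M *\<^sub>R One) :: 'b set"
    define E where "E N c = ?box \<inter> coord_proj A' -` (h ` Q N c)" for N c
    have E_borel [measurable]: "E N c \<in> sets borel" for N c
    proof -
      have "compact (h ` Q N c)"
        by (rule compact_continuous_image[OF _ compactQ])
           (rule continuous_on_subset[OF lipschitz_on_continuous_on[OF h]]; auto simp: Q_def)
      then have "closed (coord_proj A' -` (h ` Q N c))"
        by (intro continuous_closed_vimage[OF compact_imp_closed])
           (use contP in \<open>auto simp: continuous_on_eq_continuous_at\<close>)
      then show ?thesis unfolding E_def by simp
    qed
    \<comment> \<open>Volume of a box containing \<open>E N c\<close>: in the \<open>m\<close>
      directions of \<open>A'\<close> the image of a cell stays within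
      \<open>L * (real m * \<delta> N)\<close> of any one of its points; the remaining directions
      have the side \<open>2 * M\<close> of the large box.\<close>
    define K where "K N = (2 * (L * (real m * \<delta> N))) ^ m * (2 * M) ^ (DIM('b) - m)" for N
    have card_A': "card (Basis - A') = DIM('b) - m"
      by (simp add: card_Diff_subset[OF fin(2) A'] m_def card)
    have emE: "emeasure lborel (E N c) \<le> ennreal (K N)" for N c
    proof (cases "E N c = {}")
      case False
      then obtain v where v: "v \<in> E N c" by blast
      let ?r = "L * (real m * \<delta> N)"
      have r: "?r \<ge> 0" using L \<delta>[of N] by simp
      define l u where "l = (\<Sum>b\<in>Basis. (if b \<in> A' then v \<bullet> b - ?r else - M) *\<^sub>R b)"
        and "u = (\<Sum>b\<in>Basis. (if b \<in> A' then v \<bullet> b + ?r else M) *\<^sub>R b)"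
      have "E N c \<subseteq> cbox l u"
      proof
        fix z assume z: "z \<in> E N c"
        obtain s t where st: "s \<in> Q N c" "t \<in> Q N c" "h s = coord_proj A' z" "h t = coord_proj A' v"
          using z v by (auto simp: E_def)
        have "norm (h s - h t) \<le> L * norm (s - t)"
          using h st(1,2) by (auto simp: lipschitz_on_def dist_norm Q_def)
        also have "\<dots> \<le> ?r" using diam[OF st(1,2)] L by (rule mult_left_mono)
        finally have hst: "norm (h s - h t) \<le> ?r" .
        have "l \<bullet> b \<le> z \<bullet> b \<and> z \<bullet> b \<le> u \<bullet> b" if b: "b \<in> Basis" for b
        proof (cases "b \<in> A'")
          case True
          have "\<bar>(h s - h t) \<bullet> b\<bar> \<le> ?r" using Basis_le_norm[OF b] hst by (rule order_trans)
          then show ?thesis using True b st(3,4)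
            by (simp add: l_def u_def inner_diff_left coord_proj_inner[OF A'] abs_le_iff)
        next
          case False
          then show ?thesis using z b by (simp add: l_def u_def E_def mem_box)
        qed
        then show "z \<in> cbox l u" by (simp add: mem_box)
      qed
      then have "emeasure lborel (E N c) \<le> emeasure lborel (cbox l u)"
        by (rule emeasure_mono) simp
      also have "\<dots> = ennreal (\<Prod>b\<in>Basis. (u - l) \<bullet> b)"
        by (rule emeasure_lborel_cbox) (use r that in \<open>auto simp: l_def u_def\<close>)
      also have "(\<Prod>b\<in>Basis. (u - l) \<bullet> b) = (\<Prod>b\<in>Basis. if b \<in> A' then 2 * ?r else 2 * M)"
        by (rule prod.cong) (auto simp: l_def u_def inner_diff_left)
      also have "\<dots> = (\<Prod>b\<in>Basis \<inter> {b. b \<in> A'}. 2 * ?r) * (\<Prod>b\<in>Basis \<inter> - {b. b \<in> A'}. 2 * M)"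
        by (rule prod.If_cases) simp
      also have "Basis \<inter> {b. b \<in> A'} = A'" using A' by auto
      also have "Basis \<inter> - {b. b \<in> A'} = Basis - A'" by auto
      finally show ?thesis by (simp add: K_def card_A' m_def card)
    qed simp
    define n where "n N v = (\<Sum>c\<in>C N. indicator (E N c) v :: ennreal)" for N v
    have finC: "finite (C N)" for N unfolding C_def using fin(1) by (intro finite_PiE) auto
    have cardC: "card (C N) = Suc N ^ m" for N
      unfolding C_def m_def using fin(1) by (simp add: card_PiE)
    have n_meas [measurable]: "n N \<in> borel_measurable lborel" for N
      unfolding n_def by measurable
    have int_n: "(\<integral>\<^sup>+v. n N v \<partial>lborel) \<le> ennreal ((4 * L * real m * R) ^ m * (2 * M) ^ (DIM('b) - m))" for N
    proof -
      have K0: "K N \<ge> 0" using L \<delta>[of N] that by (simp add: K_def)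
      have "(\<integral>\<^sup>+v. n N v \<partial>lborel) = (\<Sum>c\<in>C N. emeasure lborel (E N c))"
        unfolding n_def by (subst nn_integral_sum) auto
      also have "\<dots> \<le> (\<Sum>c\<in>C N. ennreal (K N))" by (intro sum_mono emE)
      also have "\<dots> = ennreal (real (Suc N ^ m) * K N)"
        using K0 cardC by (simp add: ennreal_mult ennreal_of_nat_eq_real_of_nat)
      also have "real (Suc N ^ m) * K N = (real (Suc N) * (2 * (L * (real m * \<delta> N)))) ^ m * (2 * M) ^ (DIM('b) - m)"
        unfolding K_def by (simp add: power_mult_distrib)
      \<comment> \<open>The number of cells and their shrinking size cancel here, which gives a
        bound independent of \<open>N\<close>.\<close>
      also have "real (Suc N) * (2 * (L * (real m * \<delta> N))) = 4 * L * real m * R"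
        by (simp add: \<delta>_def field_simps)
      finally show ?thesis .
    qed
    have "(\<integral>\<^sup>+v. liminf (\<lambda>N. n N v) \<partial>lborel) \<le> liminf (\<lambda>N. \<integral>\<^sup>+v. n N v \<partial>lborel)"
      by (rule nn_integral_liminf) measurable
    also have "\<dots> \<le> liminf (\<lambda>N. ennreal ((4 * L * real m * R) ^ m * (2 * M) ^ (DIM('b) - m)))"
      by (intro Liminf_mono always_eventually allI int_n)
    also have "\<dots> < \<infinity>" by (simp add: Liminf_const)
    finally have "AE v in lborel. liminf (\<lambda>N. n N v) \<noteq> \<infinity>"
      by (intro nn_integral_noteq_infinite) auto
    then have "AE v in lborel. v \<notin> {v. liminf (\<lambda>N. n N v) = \<infinity>}" by simp
    then have "{v. liminf (\<lambda>N. n N v) = \<infinity>} \<in> null_sets lborel"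
      by (subst (asm) AE_iff_null_sets[symmetric]) measurable
    then have "negligible {v. liminf (\<lambda>N. n N v) = \<infinity>}"
      unfolding negligible_iff_null_sets by (rule null_sets_completionI)
    moreover have "liminf (\<lambda>N. n N v) = \<infinity>"
      if v: "v \<in> ?box" and inf: "infinite {s\<in>S. h s = coord_proj A' v}" for v
    proof -
      have "of_nat k \<le> liminf (\<lambda>N. n N v)" for k
      proof (rule Liminf_bounded)
        obtain G where G: "finite G" "card G = k" "G \<subseteq> {s\<in>S. h s = coord_proj A' v}"
          using infinite_arbitrarily_large[OF inf] by blast
        obtain e where e: "e > 0" "\<And>s t. s \<in> G \<Longrightarrow> t \<in> G \<Longrightarrow> s \<noteq> t \<Longrightarrow> e \<le> dist s t"
        proof -
          \<comment> \<open>Positive distances between points of \<open>G\<close>. Inserting 1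
            before taking the minimum covers the case that \<open>G\<close> has fewer than two
            points.\<close>
          define D where "D = (\<lambda>(s, t). dist s t) ` {(s, t) \<in> G \<times> G. s \<noteq> t}"
          have D: "finite D" "\<And>d. d \<in> D \<Longrightarrow> d > 0"
            using G(1) by (auto simp: D_def intro: finite_subset[of _ "G \<times> G"])
          then have "Min (insert 1 D) > 0" by simp
          moreover have "Min (insert 1 D) \<le> dist s t" if "s \<in> G" "t \<in> G" "s \<noteq> t" for s t
            using D(1) that by (intro Min_le) (auto simp: D_def)
          ultimately show ?thesis using that by blast
        qed
        have "(\<lambda>N. real m * \<delta> N) \<longlonglongrightarrow> real m * 0"
          unfolding \<delta>_def
          by (intro tendsto_mult tendsto_const LIMSEQ_Suc[OF lim_const_over_n])
        then have "\<forall>\<^sub>F N in sequentially. real m * \<delta> N < e"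
          using e(1) by (intro order_tendstoD(2)[where y="real m * 0"]) auto
        \<comment> \<open>Once a cell has diameter below \<open>e\<close>, the \<open>k\<close>
          chosen points of the fiber lie in different cells, so at least \<open>k\<close> cells are
          hit.\<close>
        then show "\<forall>\<^sub>F N in sequentially. of_nat k \<le> n N v"
        proof eventually_elim
          fix N assume N: "real m * \<delta> N < e"
          obtain c where c: "\<And>s. s \<in> S \<Longrightarrow> c s \<in> C N \<and> s \<in> Q N (c s)"
            using bchoice[of S "\<lambda>s c. c \<in> C N \<and> s \<in> Q N c"] cover[of _ N] by blast
          have inj: "inj_on c G"
          proof
            fix s t assume st: "s \<in> G" "t \<in> G" "c s = c t"
            have "s \<in> S" "t \<in> S" using st G(3) by auto
            then have "s \<in> Q N (c s)" "t \<in> Q N (c s)" using c[of s] c[of t] st(3) by simp_all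
            from diam[OF this] have "dist s t < e" using N by (simp add: dist_norm)
            then show "s = t" using e(2) st by force
          qed
          have inE: "v \<in> E N (c s)" if "s \<in> G" for s
          proof -
            have "s \<in> S" "h s = coord_proj A' v" using that G(3) by auto
            then show ?thesis using v c[of s] unfolding E_def by (metis IntI imageI vimageI2)
          qed
          have "of_nat k = (\<Sum>d\<in>c ` G. 1 :: ennreal)" using card_image[OF inj] G(2) by simp
          also have "\<dots> = (\<Sum>d\<in>c ` G. indicator (E N d) v)" using inE by (intro sum.cong) auto
          also have "\<dots> \<le> n N v" unfolding n_def
            by (intro sum_mono2 finC) (use c G(3) in auto)
          finally show "of_nat k \<le> n N v" .
        qed
      qed
      then show ?thesis
        by (metis ennreal_Ex_less_of_nat infinity_ennreal_def leD top.not_eq_extremum)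
    qed
    ultimately show ?thesis by (elim negligible_subset) auto
  qed
  note bounded = this
  have "negligible (\<Union>k. {v. infinite {s\<in>S. h s = coord_proj A' v}}
      \<inter> cbox (- real (Suc k) *\<^sub>R One) (real (Suc k) *\<^sub>R One))"
    by (rule negligible_countable_Union) (use bounded[of "real (Suc _)"] in \<open>auto simp del: of_nat_Suc\<close>)
  moreover have "\<exists>k. v \<in> cbox (- real (Suc k) *\<^sub>R One) (real (Suc k) *\<^sub>R One)" for v :: 'b
  proof -
    obtain k where k: "norm v \<le> real k" using real_arch_simple by blast
    have "- real (Suc k) \<le> v \<bullet> b \<and> v \<bullet> b \<le> real (Suc k)" if "b \<in> Basis" for b
      using Basis_le_norm[OF that, of v] k by (auto simp: abs_le_iff)
    then show ?thesis by (intro exI[of _ k]) (simp add: mem_box del: of_nat_Suc)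
  qed
  ultimately show ?thesis by (elim negligible_subset) auto
qed

section \<open>Sums over fibers\<close>

text \<open>The index set may be uncountable. If every level set \<open>F n\<close> is finite,
  \<open>f\<close> is supported on their countable union and monotone convergence applies. If one is
  infinite, the sum already diverges there.\<close>

lemma infsum_ennreal_eq_nn_integral:
  fixes f :: "'a \<Rightarrow> ennreal"
  shows "infsum f A = (\<integral>\<^sup>+x. f x \<partial>count_space A)"
proof (rule antisym)
  have "sum f F \<le> (\<integral>\<^sup>+x. f x \<partial>count_space A)" if "finite F" "F \<subseteq> A" for F
  proof -
    have "sum f F = (\<integral>\<^sup>+x. f x * indicator F x \<partial>count_space A)"
      using that by (subst nn_integral_count_space'[of F]) (auto simp: indicator_def)
    also have "\<dots> \<le> (\<integral>\<^sup>+x. f x \<partial>count_space A)"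
      by (intro nn_integral_mono) (simp add: indicator_def)
    finally show ?thesis .
  qed
  then show "infsum f A \<le> (\<integral>\<^sup>+x. f x \<partial>count_space A)"
    by (subst nonneg_infsum_complete) (auto intro!: SUP_least)
next
  have mono: "infsum f S \<le> infsum f A" if "S \<subseteq> A" for S
    by (rule infsum_mono_neutral) (use that in \<open>auto intro: nonneg_summable_on_complete\<close>)
  define F where "F n = {x\<in>A. ennreal (1 / real (Suc n)) \<le> f x}" for n
  show "(\<integral>\<^sup>+x. f x \<partial>count_space A) \<le> infsum f A"
  proof (cases "\<forall>n. finite (F n)")
    case True
    have le: "(\<integral>\<^sup>+x. f x * indicator (F n) x \<partial>count_space A) \<le> infsum f A" for n
    proof -
      have "(\<integral>\<^sup>+x. f x * indicator (F n) x \<partial>count_space A) = sum f (F n)"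
        using True by (subst nn_integral_count_space'[of "F n"]) (auto simp: F_def)
      then show ?thesis using True mono[of "F n"] by (simp add: F_def)
    qed
    have inc: "incseq (\<lambda>n x. f x * indicator (F n) x)"
    proof (intro incseq_SucI le_funI)
      fix n x
      have "ennreal (1 / real (Suc (Suc n))) \<le> ennreal (1 / real (Suc n))"
        by (intro ennreal_leI frac_le) auto
      then have "F n \<subseteq> F (Suc n)" unfolding F_def by (auto simp del: of_nat_Suc elim: order_trans[rotated])
      then show "f x * indicator (F n) x \<le> f x * indicator (F (Suc n)) x"
        by (auto simp: indicator_def)
    qed
    have "(\<integral>\<^sup>+x. f x \<partial>count_space A) = (\<integral>\<^sup>+x. (SUP n. f x * indicator (F n) x) \<partial>count_space A)"
    proof (intro nn_integral_cong antisym)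
      fix x assume "x \<in> space (count_space A)"
      then have x: "x \<in> A" by simp
      show "f x \<le> (SUP n. f x * indicator (F n) x)"
      proof (cases "f x = 0")
        case False
        then obtain e where e: "0 < e" "ennreal e \<le> f x"
        proof (cases "f x")
          case (real r)
          then show thesis using False that[of r] by auto
        next
          case top
          then show thesis using that[of 1] by simp
        qed
        obtain n where "inverse (real (Suc n)) < e" using reals_Archimedean[OF e(1)] by blast
        then have "ennreal (1 / real (Suc n)) \<le> ennreal e"
          by (intro ennreal_leI) (simp add: inverse_eq_divide)
        then have "ennreal (1 / real (Suc n)) \<le> f x" using e(2) by (rule order_trans)
        then show ?thesis using x by (intro SUP_upper2[of n]) (auto simp: F_def)
      qed simp
      show "(SUP n. f x * indicator (F n) x) \<le> f x"
        by (rule SUP_least) (simp add: indicator_def)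
    qed
    also have "\<dots> = (SUP n. \<integral>\<^sup>+x. f x * indicator (F n) x \<partial>count_space A)"
      by (rule nn_integral_monotone_convergence_SUP[OF inc]) simp
    also have "\<dots> \<le> infsum f A" by (rule SUP_least) (rule le)
    finally show ?thesis .
  next
    case False
    then obtain n where "infinite (F n)" by blast
    then have "infsum f (F n) = \<infinity>"
      by (intro infsum_superconst_infinite_ennreal[where b="ennreal (1 / real (Suc n))"])
         (auto simp: F_def)
    then show ?thesis using mono[of "F n"] by (simp add: F_def top_unique)
  qed
qed

text \<open>As an integral against counting measure, the sum inherits linearity and monotone
  convergence in \<open>h\<close>.\<close>

definition fiber_sum :: "'a set \<Rightarrow> ('a \<Rightarrow> 'b) \<Rightarrow> ('a \<Rightarrow> ennreal) \<Rightarrow> 'b \<Rightarrow> ennreal" where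
  "fiber_sum P f h \<theta> = (\<integral>\<^sup>+y. h y \<partial>count_space {y\<in>P. f y = \<theta>})"

section \<open>F-sigma sets and Borel measurability of fiber sums\<close>

lemma fsigma_in_borel:
  assumes "fsigma_in euclidean S"
  shows "S \<in> sets borel"
proof -
  obtain C where "\<And>n::nat. closed (C n)" "\<Union> (range C) = S"
    using assms unfolding fsigma_in_ascending by (auto simp flip: closed_closedin)
  then show ?thesis by (auto intro: borel_closed)
qed

text \<open>Closed sets are countable unions of compact ones, and continuous images of compact sets
  are closed. Here \<open>undefined\<close> serves as an arbitrary center of the balls.\<close>

lemma fsigma_in_image:
  fixes f :: "'a::heine_borel \<Rightarrow> 'b::metric_space"
  assumes "fsigma_in euclidean S" "continuous_on S f"
  shows "fsigma_in euclidean (f ` S)"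
proof -
  obtain C where C: "\<And>n::nat. closed (C n)" "\<Union> (range C) = S"
    using assms(1) unfolding fsigma_in_ascending by (auto simp flip: closed_closedin)
  define K where "K n k = C n \<inter> cball undefined (real k)" for n k :: nat
  have "closed (f ` K n k)" for n k
  proof (intro compact_imp_closed compact_continuous_image)
    show "continuous_on (K n k) f" using assms(2) by (rule continuous_on_subset) (use C(2) in \<open>auto simp: K_def\<close>)
    show "compact (K n k)" unfolding K_def using C(1) by (intro closed_Int_compact) auto
  qed
  moreover have "f ` S = (\<Union>n. \<Union>k. f ` K n k)"
  proof -
    have "\<exists>k. y \<in> cball undefined (real k)" for y :: 'a
      using real_arch_simple[of "dist undefined y"] by auto
    then show ?thesis using C(2) by (fastforce simp: K_def)
  qed
  moreover have "f ` S = \<Union> (range (\<lambda>(n, k). f ` K n k))"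
    using \<open>f ` S = _\<close> by auto
  moreover have "fsigma_in euclidean (\<Union> (range (\<lambda>(n, k). f ` K n k)))"
    by (rule fsigma_in_Union) (use calculation(1) in \<open>auto intro: closed_imp_fsigma_in\<close>)
  ultimately show ?thesis by simp
qed

lemma open_imp_fsigma_in_euclidean:
  "open (S :: 'a::metric_space set) \<Longrightarrow> fsigma_in euclidean S"
  by (rule open_imp_fsigma_in[OF metrizable_space_euclidean]) simp

text \<open>For the \<open>j\<close>-th of a sequence of finite partitions that eventually separates any two points,
  sum over the cells the supremum of \<open>h\<close> over the part of the fiber in the cell.  This is Borel in
  \<open>\<theta>\<close> because images of \<open>F\<^sub>\<sigma>\<close> sets are \<open>F\<^sub>\<sigma>\<close>, and the supremum over \<open>j\<close> is the full sum.\<close>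

lemma borel_measurable_fiber_sum:
  fixes f :: "'a::euclidean_space \<Rightarrow> 'b::metric_space" and h :: "'a \<Rightarrow> ennreal"
  assumes f: "continuous_on P f"
    and h: "\<And>t. fsigma_in euclidean {y\<in>P. t < h y}"
  shows "fiber_sum P f h \<in> borel_measurable borel"
proof -
  obtain \<B> :: "'a set set" where \<B>: "countable \<B>" "\<And>C. C \<in> \<B> \<Longrightarrow> open C"
    "\<And>S. open S \<Longrightarrow> \<exists>U. U \<subseteq> \<B> \<and> S = \<Union>U"
    using univ_second_countable by blast
  \<comment> \<open>Inserting \<open>UNIV\<close> guarantees a nonempty family to enumerate and does
    not affect separation of points.\<close>
  define B where "B = from_nat_into (insert UNIV \<B>)"
  have range_B: "range B = insert UNIV \<B>"
    unfolding B_def using \<B>(1) by (intro range_from_nat_into) auto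
  then have B: "open (B n)" for n using \<B>(2) by (metis insertE open_UNIV rangeI)
  have sep: "\<exists>i. x \<in> B i \<and> y \<notin> B i" if "x \<noteq> y" for x y
  proof -
    obtain U where U: "open U" "x \<in> U" "y \<notin> U" using t1_space[OF \<open>x \<noteq> y\<close>] by blast
    then obtain C where "C \<in> \<B>" "x \<in> C" "C \<subseteq> U" using \<B>(3)[OF U(1)] by blast
    moreover then obtain i where "C = B i" using range_B by blast
    ultimately show ?thesis using U(3) by blast
  qed
  \<comment> \<open>A cell records which of the first \<open>j\<close> basic open sets contain a
    point; the patterns \<open>I\<close> in \<open>Pow {..<j}\<close> partition the space.\<close>
  define cell where "cell j I = {y. \<forall>i<j. y \<in> B i \<longleftrightarrow> i \<in> I}" for j I
  have cell_fsigma: "fsigma_in euclidean (cell j I)" for j I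
  proof (induction j)
    case 0
    then show ?case using fsigma_in_topspace[of "euclidean :: 'a topology"] by (simp add: cell_def)
  next
    case (Suc j)
    have "fsigma_in euclidean (if j \<in> I then B j else - B j)"
      using B[of j] open_imp_fsigma_in_euclidean[OF B, of j] closed_imp_fsigma_in[of euclidean "- B j"]
      by (simp add: closed_Compl)
    moreover have "cell (Suc j) I = cell j I \<inter> (if j \<in> I then B j else - B j)"
      by (auto simp: cell_def less_Suc_eq)
    ultimately show ?case using Suc.IH by (simp only: fsigma_in_Int)
  qed
  define g where "g j \<theta> = (\<Sum>I\<in>Pow {..<j}. SUP y\<in>{y\<in>P \<inter> cell j I. f y = \<theta>}. h y)" for j \<theta>
  have "(\<lambda>\<theta>. SUP y\<in>{y\<in>P \<inter> cell j I. f y = \<theta>}. h y) \<in> borel_measurable borel" for j I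
  proof (rule borel_measurableI_greater)
    fix t
    have "{\<theta> \<in> space borel. t < (SUP y\<in>{y\<in>P \<inter> cell j I. f y = \<theta>}. h y)} =
      f ` ({y\<in>P. t < h y} \<inter> cell j I)"
      by (auto simp: less_SUP_iff)
    also have "fsigma_in euclidean \<dots>"
      by (intro fsigma_in_image fsigma_in_Int h cell_fsigma continuous_on_subset[OF f]) auto
    finally show "{\<theta> \<in> space borel. t < (SUP y\<in>{y\<in>P \<inter> cell j I. f y = \<theta>}. h y)} \<in> sets borel"
      by (rule fsigma_in_borel)
  qed
  then have g: "g j \<in> borel_measurable borel" for j
    unfolding g_def by (intro borel_measurable_sum) auto
  have "fiber_sum P f h \<theta> = (SUP j. g j \<theta>)" for \<theta>
  proof (rule antisym)
    let ?F = "{y\<in>P. f y = \<theta>}"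
    have "sum h G \<le> (SUP j. g j \<theta>)" if G: "finite G" "G \<subseteq> ?F" for G
    proof -
      obtain s where s: "\<And>x y. x \<noteq> y \<Longrightarrow> x \<in> B (s x y) \<and> y \<notin> B (s x y)" using sep by metis
      \<comment> \<open>With \<open>j\<close> above every separating index, distinct points of
        \<open>G\<close> have distinct patterns, so each contributes to a term of its own in
        \<open>g j \<theta>\<close>.\<close>
      obtain j where j: "\<And>x y. x \<in> G \<Longrightarrow> y \<in> G \<Longrightarrow> s x y < j"
      proof
        fix x y assume "x \<in> G" "y \<in> G"
        then show "s x y < Suc (Max ((\<lambda>(x, y). s x y) ` (G \<times> G)))"
          using G(1) by (intro le_imp_less_Suc Max_ge) auto
      qed
      define I where "I y = {i. i < j \<and> y \<in> B i}" for y
      have "inj_on I G"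
      proof
        fix x y assume xy: "x \<in> G" "y \<in> G" "I x = I y"
        show "x = y"
        proof (rule ccontr)
          assume "x \<noteq> y"
          then have "s x y \<in> I x" "s x y \<notin> I y" using s[of x y] j[of x y] xy(1,2) \<open>x \<noteq> y\<close> unfolding I_def by simp_all
          then show False using xy by simp
        qed
      qed
      then have "sum h G = (\<Sum>J\<in>I ` G. h (the_inv_into G I J))"
        by (subst sum.reindex) (auto simp: the_inv_into_f_f intro!: sum.cong)
      also have "\<dots> \<le> (\<Sum>J\<in>I ` G. SUP y\<in>{y\<in>P \<inter> cell j J. f y = \<theta>}. h y)"
      proof (rule sum_mono)
        fix J assume "J \<in> I ` G"
        then obtain y where "y \<in> G" "J = I y" by blast
        then show "h (the_inv_into G I J) \<le> (SUP y\<in>{y\<in>P \<inter> cell j J. f y = \<theta>}. h y)"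
          using G(2) the_inv_into_f_f[OF \<open>inj_on I G\<close>]
          by (auto intro!: SUP_upper simp: cell_def I_def)
      qed
      also have "\<dots> \<le> g j \<theta>"
        unfolding g_def by (intro sum_mono2) (auto simp: I_def)
      also have "\<dots> \<le> (SUP j. g j \<theta>)" by (rule SUP_upper) simp
      finally show ?thesis .
    qed
    then show "fiber_sum P f h \<theta> \<le> (SUP j. g j \<theta>)"
      unfolding fiber_sum_def infsum_ennreal_eq_nn_integral[symmetric]
      by (subst nonneg_infsum_complete) (auto intro!: SUP_least)
    have "g j \<theta> \<le> fiber_sum P f h \<theta>" for j
    proof -
      have "g j \<theta> \<le> (\<Sum>I\<in>Pow {..<j}. \<integral>\<^sup>+y. h y * indicator (cell j I) y \<partial>count_space ?F)"
        unfolding g_def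
      proof (intro sum_mono SUP_least)
        fix I y assume "y \<in> {y \<in> P \<inter> cell j I. f y = \<theta>}"
        then show "h y \<le> (\<integral>\<^sup>+y. h y * indicator (cell j I) y \<partial>count_space ?F)"
          by (intro order_trans[OF _ nn_integral_ge_point[of y]]) auto
      qed
      also have "\<dots> = (\<integral>\<^sup>+y. (\<Sum>I\<in>Pow {..<j}. h y * indicator (cell j I) y) \<partial>count_space ?F)"
        by (rule nn_integral_sum[symmetric]) simp
      also have "\<dots> \<le> (\<integral>\<^sup>+y. h y \<partial>count_space ?F)"
      proof (rule nn_integral_mono)
        fix y
        \<comment> \<open>Exactly one pattern in \<open>Pow {..<j}\<close> belongs to
          \<open>y\<close>, so the sum over patterns counts \<open>h y\<close> only once.\<close>
        have eq: "I = {i. i < j \<and> y \<in> B i}" if "I \<in> Pow {..<j}" "y \<in> cell j I" for I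
          using that by (auto simp: cell_def)
        have "(\<Sum>I\<in>Pow {..<j}. h y * indicator (cell j I) y)
          = (\<Sum>I\<in>{{i. i < j \<and> y \<in> B i}}. h y * indicator (cell j I) y)"
          by (rule sum.mono_neutral_right) (use eq in \<open>auto simp: indicator_def\<close>)
        also have "\<dots> = h y * indicator (cell j {i. i < j \<and> y \<in> B i}) y"
          by (simp only: sum.insert sum.empty finite.emptyI empty_iff add_0_right not_False_eq_True)
        also have "\<dots> \<le> h y" by (simp add: indicator_def)
        finally show "(\<Sum>I\<in>Pow {..<j}. h y * indicator (cell j I) y) \<le> h y" .
      qed
      finally show ?thesis by (simp add: fiber_sum_def)
    qed
    then show "(SUP j. g j \<theta>) \<le> fiber_sum P f h \<theta>" by (intro SUP_least)
  qed
  then have "fiber_sum P f h = (\<lambda>\<theta>. SUP j. g j \<theta>)" by (rule ext)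
  with g show ?thesis by simp
qed

section \<open>Fiber counts as a measure with a density\<close>

lemma fiber_sum_cong:
  assumes "\<And>y. y \<in> P \<Longrightarrow> f y = \<theta> \<Longrightarrow> h y = h' y"
  shows "fiber_sum P f h \<theta> = fiber_sum P f h' \<theta>"
  unfolding fiber_sum_def using assms by (intro nn_integral_cong) auto

lemma fiber_sum_mono:
  assumes "\<And>y. y \<in> P \<Longrightarrow> f y = \<theta> \<Longrightarrow> h y \<le> h' y"
  shows "fiber_sum P f h \<theta> \<le> fiber_sum P f h' \<theta>"
  unfolding fiber_sum_def using assms by (intro nn_integral_mono) auto

lemma fiber_sum_indicator:
  assumes "K \<subseteq> P"
  shows "fiber_sum P f (indicator K) \<theta> = emeasure (count_space UNIV) {y\<in>K. f y = \<theta>}"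
proof -
  have "fiber_sum P f (indicator K) \<theta>
      = (\<integral>\<^sup>+y. indicator K y * indicator {y\<in>P. f y = \<theta>} y \<partial>count_space UNIV)"
    unfolding fiber_sum_def by (rule nn_integral_count_space_indicator) simp
  also have "\<dots> = (\<integral>\<^sup>+y. indicator {y\<in>K. f y = \<theta>} y \<partial>count_space UNIV)"
    using assms by (intro nn_integral_cong) (auto split: split_indicator)
  finally show ?thesis by simp
qed

lemma fiber_sum_eq_0:
  assumes "\<And>y. y \<in> P \<Longrightarrow> f y = \<theta> \<Longrightarrow> h y = 0"
  shows "fiber_sum P f h \<theta> = 0"
proof -
  have "fiber_sum P f h \<theta> = fiber_sum P f (\<lambda>_. 0) \<theta>" using assms by (rule fiber_sum_cong)
  then show ?thesis by (simp add: fiber_sum_def)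
qed

text \<open>A single time \<open>k\<close>: \<open>f\<close> plays the role of
  \<open>g\<^sub>k\<close> and \<open>P\<close> that of its domain. \<open>null_image\<close> speaks
  of measurable subsets of the image because \<open>lebesgue_class\<close> constrains only sets in
  \<open>sets \<mu>\<close>. The cover \<open>\<K>\<close> serves twice, for measurable null hulls
  of images and for sigma-finiteness.\<close>

locale fiber_counting = \<mu>: finite_measure \<mu> + \<nu>: finite_measure \<nu>
  for \<mu> :: "'b::euclidean_space measure" and \<nu> :: "'a::euclidean_space measure" +
  fixes \<Theta> :: "'b set" and Y P :: "'a set" and f :: "'a \<Rightarrow> 'b" and \<K> :: "'a set set"
  assumes sets_\<mu>: "sets \<mu> = sets (restrict_space borel \<Theta>)"
    and sets_\<nu>: "sets \<nu> = sets (restrict_space borel Y)"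
    and closed_Y: "closed Y"
    and P: "P \<subseteq> Y" "fsigma_in euclidean P"
    and f: "continuous_on P f" "f ` P \<subseteq> \<Theta>"
    and null_image: "\<And>N Z. N \<in> null_sets \<nu> \<Longrightarrow> N \<subseteq> P \<Longrightarrow> Z \<in> sets \<mu> \<Longrightarrow> Z \<subseteq> f ` N \<Longrightarrow> Z \<in> null_sets \<mu>"
    and \<K>: "countable \<K>" "P \<subseteq> \<Union>\<K>"
      "\<And>K. K \<in> \<K> \<Longrightarrow> K \<subseteq> P \<and> fsigma_in euclidean K \<and> (AE \<theta> in \<mu>. finite {y\<in>K. f y = \<theta>})"
begin

lemma space_\<nu>: "space \<nu> = Y"
  using sets_eq_imp_space_eq[OF sets_\<nu>] by (simp add: space_restrict_space)

lemma space_\<mu>: "space \<mu> = \<Theta>"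
  using sets_eq_imp_space_eq[OF sets_\<mu>] by (simp add: space_restrict_space)

lemma sets_\<nu>_iff: "E \<in> sets \<nu> \<longleftrightarrow> E \<in> sets borel \<and> E \<subseteq> Y"
  unfolding sets_\<nu> using closed_Y by (auto simp: sets_restrict_space_iff)

lemma P_sets: "P \<in> sets \<nu>"
  using P fsigma_in_borel by (simp add: sets_\<nu>_iff)

lemma borel_measurable_\<mu>I: "g \<in> borel_measurable borel \<Longrightarrow> g \<in> borel_measurable \<mu>"
  unfolding measurable_cong_sets[OF sets_\<mu> refl] by (rule measurable_restrict_space1)

lemma borel_Int_\<Theta>_sets: "Z \<in> sets borel \<Longrightarrow> Z \<inter> \<Theta> \<in> sets \<mu>"
  unfolding sets_\<mu> sets_restrict_space by auto

text \<open>Inner and outer regularity concern measures on the Borel sets of the whole space, so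
  \<open>\<nu>\<close> is extended from \<open>Y\<close> by zero.\<close>

definition \<nu>_borel :: "'a measure" where
  "\<nu>_borel = distr \<nu> borel (\<lambda>y. y)"

lemma id_measurable: "(\<lambda>y. y) \<in> borel_measurable \<nu>"
  unfolding measurable_cong_sets[OF sets_\<nu> refl] by (rule measurable_restrict_space1) simp

lemma emeasure_\<nu>_borel: "B \<in> sets borel \<Longrightarrow> emeasure \<nu>_borel B = emeasure \<nu> (B \<inter> Y)"
  unfolding \<nu>_borel_def by (simp add: emeasure_distr id_measurable space_\<nu>)

lemma emeasure_\<nu>_borel_finite: "emeasure \<nu>_borel (space \<nu>_borel) \<noteq> \<infinity>"
  using \<nu>.emeasure_finite[of "Y"] by (simp add: emeasure_\<nu>_borel \<nu>_borel_def[THEN arg_cong, of space])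

lemma borel_Int_Y: "B \<in> sets borel \<Longrightarrow> B \<inter> Y \<in> sets \<nu>"
  using closed_Y by (simp add: sets_\<nu>_iff)

text \<open>The image \<open>f ` N\<close> need not be Borel.  Over \<open>K \<in> \<K>\<close> it is contained in the intersection of the
  images of a decreasing sequence of open neighborhoods of \<open>N\<close>; a point of this intersection with finite fiber
  has, by the pigeonhole principle, a preimage in all the neighborhoods.\<close>

lemma null_hull:
  assumes N: "N \<in> null_sets \<nu>" "N \<subseteq> P"
  obtains Z where "Z \<in> null_sets \<mu>" "f ` N \<subseteq> Z"
proof -
  have "\<exists>Z\<in>null_sets \<mu>. f ` (N \<inter> K) \<subseteq> Z" if "K \<in> \<K>" for K
  proof -
    have K: "K \<subseteq> P" "fsigma_in euclidean K" "AE \<theta> in \<mu>. finite {y\<in>K. f y = \<theta>}"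
      using \<K>(3)[OF that] by auto
    have NK: "N \<in> sets borel" using N(1) by (auto simp: sets_\<nu>_iff)
    have "emeasure \<nu>_borel N = 0" using N emeasure_\<nu>_borel[OF NK] P(1) by (simp add: Int_absorb2 null_setsD1)
    moreover have "emeasure \<nu>_borel N = (INF U\<in>{U. N \<subseteq> U \<and> open U}. emeasure \<nu>_borel U)"
      by (rule outer_regular[OF _ emeasure_\<nu>_borel_finite NK]) (simp add: \<nu>_borel_def)
    ultimately have inf: "(INF U\<in>{U. N \<subseteq> U \<and> open U}. emeasure \<nu>_borel U) = 0" by simp
    have "\<exists>U. N \<subseteq> U \<and> open U \<and> emeasure \<nu>_borel U < ennreal (1 / real (Suc n))" for n
    proof -
      have "(INF U\<in>{U. N \<subseteq> U \<and> open U}. emeasure \<nu>_borel U) < ennreal (1 / real (Suc n))"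
        unfolding inf by simp
      then show ?thesis unfolding INF_less_iff by blast
    qed
    then have "\<forall>n. \<exists>U. N \<subseteq> U \<and> open U \<and> emeasure \<nu>_borel U < ennreal (1 / real (Suc n))" by blast
    from choice[OF this] obtain U where
      U: "\<And>n. N \<subseteq> U n" "\<And>n. open (U n)" "\<And>n. emeasure \<nu>_borel (U n) < ennreal (1 / real (Suc n))"
      by blast
    define V where "V n = K \<inter> (\<Inter>i\<le>n. U i)" for n
    have V_fsigma: "fsigma_in euclidean (V n)" for n
      unfolding V_def by (intro fsigma_in_Int K(2) open_imp_fsigma_in_euclidean open_INT) (use U(2) in auto)
    have V_mono: "V n \<subseteq> V m" if "m \<le> n" for m n using that by (auto simp: V_def)
    have "f ` V n \<in> sets borel" for n
      by (intro fsigma_in_borel fsigma_in_image V_fsigma continuous_on_subset[OF f(1)]) (use K(1) in \<open>auto simp: V_def\<close>)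
    then have "(\<Inter>n. f ` V n) \<in> sets borel" by auto
    then have Z_sets: "(\<Inter>n. f ` V n) \<in> sets \<mu>"
    proof -
      have "V 0 \<subseteq> P" using K(1) by (auto simp: V_def)
      then have "(\<Inter>n. f ` V n) \<subseteq> \<Theta>" using f(2) by blast
      then show ?thesis using borel_Int_\<Theta>_sets[OF \<open>(\<Inter>n. f ` V n) \<in> sets borel\<close>] by (simp add: Int_absorb2)
    qed
    \<comment> \<open>\<open>M\<close> may be larger than the part of \<open>N\<close> in
      \<open>K\<close>, but it lies in every \<open>U n\<close> and is therefore still null. It is
      \<open>M\<close>, not \<open>N\<close>, whose image contains a measurable set big enough to
      cover the image of \<open>N\<close> in \<open>K\<close> up to \<open>X\<close>.\<close>
    define M where "M = (\<Inter>n. V n)"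
    have M: "M \<in> sets \<nu>" "M \<subseteq> P" "M \<subseteq> Y"
    proof -
      have "M \<in> sets borel" unfolding M_def using fsigma_in_borel[OF V_fsigma] by auto
      then show "M \<in> sets \<nu>" "M \<subseteq> P" "M \<subseteq> Y" using K(1) P(1) by (auto simp: sets_\<nu>_iff M_def V_def)
    qed
    have bound: "emeasure \<nu> M \<le> ennreal (1 / real (Suc n))" for n
    proof -
      have "emeasure \<nu> M \<le> emeasure \<nu> (U n \<inter> Y)"
        using M(3) U(2) by (intro emeasure_mono borel_Int_Y) (auto simp: M_def V_def)
      also have "\<dots> \<le> ennreal (1 / real (Suc n))"
        using U(2,3)[of n] emeasure_\<nu>_borel[of "U n"] by (simp add: less_imp_le)
      finally show ?thesis .
    qed
    have "emeasure \<nu> M = 0"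
    proof -
      have "(\<lambda>n. ennreal (1 / real (Suc n))) \<longlonglongrightarrow> ennreal 0"
        by (intro tendsto_ennrealI LIMSEQ_Suc[OF lim_1_over_n])
      then have "emeasure \<nu> M \<le> ennreal 0"
        by (rule LIMSEQ_le_const) (use bound in blast)
      then show ?thesis by simp
    qed
    then have Mnull: "M \<in> null_sets \<nu>" using M by auto
    obtain X where X: "X \<in> null_sets \<mu>" "{\<theta> \<in> space \<mu>. \<not> finite {y\<in>K. f y = \<theta>}} \<subseteq> X"
      using K(3) unfolding eventually_ae_filter by blast
    have sub: "(\<Inter>n. f ` V n) - X \<subseteq> f ` M"
    proof
      fix \<theta> assume \<theta>: "\<theta> \<in> (\<Inter>n. f ` V n) - X"
      moreover have "V 0 \<subseteq> P" using K(1) by (auto simp: V_def)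
      ultimately have "\<theta> \<in> \<Theta>" using f(2) by blast
      then have fin: "finite {y\<in>K. f y = \<theta>}" using X(2) \<theta> by (auto simp: space_\<mu>)
      have "\<forall>n. \<exists>y. y \<in> V n \<and> f y = \<theta>" using \<theta> by auto
      then obtain y where y: "\<And>n. y n \<in> V n \<and> f (y n) = \<theta>" by metis
      have "range y \<subseteq> {y\<in>K. f y = \<theta>}" using y by (auto simp: V_def)
      then have "finite (range y)" using fin finite_subset by blast
      then obtain n0 where inf: "infinite {n. y n = y n0}"
        using pigeonhole_infinite[of UNIV y] by auto
      have "y n0 \<in> V n" for n
      proof -
        obtain k where "k \<ge> n" "y k = y n0"
          using inf unfolding infinite_nat_iff_unbounded_le by blast
        then show ?thesis using y[of k] V_mono by auto
      qed
      then show "\<theta> \<in> f ` M" using y[of n0] by (auto simp: M_def)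
    qed
    have "(\<Inter>n. f ` V n) - X \<in> null_sets \<mu>"
      by (rule null_image[OF Mnull M(2) _ sub]) (use Z_sets X(1) in auto)
    then have "((\<Inter>n. f ` V n) - X) \<union> X \<in> null_sets \<mu>" using X(1) by (rule null_sets.Un)
    moreover have "f ` (N \<inter> K) \<subseteq> ((\<Inter>n. f ` V n) - X) \<union> X" using U(1) by (auto simp: V_def)
    ultimately show ?thesis by blast
  qed
  then obtain Z where Z: "\<And>K. K \<in> \<K> \<Longrightarrow> Z K \<in> null_sets \<mu> \<and> f ` (N \<inter> K) \<subseteq> Z K" by metis
  show ?thesis
  proof
    show "(\<Union>K\<in>\<K>. Z K) \<in> null_sets \<mu>" using \<K>(1) Z by (intro null_sets_UN') auto
    show "f ` N \<subseteq> (\<Union>K\<in>\<K>. Z K)" using \<K>(2) N(2) Z by fastforce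
  qed
qed

lemma AE_fiber_disjoint_null:
  assumes "N \<in> null_sets \<nu>" "N \<subseteq> P"
  shows "AE \<theta> in \<mu>. \<forall>y\<in>N. f y \<noteq> \<theta>"
proof -
  obtain Z where "Z \<in> null_sets \<mu>" "f ` N \<subseteq> Z" by (rule null_hull[OF assms])
  then show ?thesis using AE_not_in[of Z \<mu>] by (auto elim!: eventually_mono)
qed

text \<open>By inner regularity \<open>E \<inter> P\<close> is a countable union \<open>F\<close> of
  compact sets up to a null set. Counts over \<open>F\<close> are Borel, and almost every fiber
  misses the rest.\<close>

lemma fiber_sum_indicator_AE_measurable:
  assumes E: "E \<in> sets \<nu>"
  shows "\<exists>g\<in>borel_measurable \<mu>. AE \<theta> in \<mu>. fiber_sum P f (indicator E) \<theta> = g \<theta>"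
proof -
  have EP: "E \<inter> P \<in> sets borel" "E \<inter> P \<subseteq> Y" using E P_sets by (auto simp: sets_\<nu>_iff)
  have "emeasure \<nu>_borel (E \<inter> P) = (SUP K\<in>{K. K \<subseteq> E \<inter> P \<and> compact K}. emeasure \<nu>_borel K)"
    by (rule inner_regular[OF _ emeasure_\<nu>_borel_finite EP(1)]) (simp add: \<nu>_borel_def)
  then have eq: "emeasure \<nu> (E \<inter> P) = (SUP K\<in>{K. K \<subseteq> E \<inter> P \<and> compact K}. emeasure \<nu>_borel K)"
    using emeasure_\<nu>_borel[OF EP(1)] EP(2) by (simp add: Int_absorb2)
  have "{K. K \<subseteq> E \<inter> P \<and> compact K} \<noteq> {}" by (auto intro: exI[of _ "{}"])
  from ennreal_SUP_countable_SUP[OF this, of "emeasure \<nu>_borel"]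
  obtain k where k: "range k \<subseteq> emeasure \<nu>_borel ` {K. K \<subseteq> E \<inter> P \<and> compact K}"
    "(SUP K\<in>{K. K \<subseteq> E \<inter> P \<and> compact K}. emeasure \<nu>_borel K) = (SUP i::nat. k i)"
    by auto
  have "\<forall>i. \<exists>K. K \<subseteq> E \<inter> P \<and> compact K \<and> k i = emeasure \<nu>_borel K"
  proof
    fix i
    have "k i \<in> emeasure \<nu>_borel ` {K. K \<subseteq> E \<inter> P \<and> compact K}" using k(1) by blast
    then show "\<exists>K. K \<subseteq> E \<inter> P \<and> compact K \<and> k i = emeasure \<nu>_borel K" by blast
  qed
  from choice[OF this] obtain C where
    C: "\<And>i. C i \<subseteq> E \<inter> P \<and> compact (C i) \<and> k i = emeasure \<nu>_borel (C i)"
    by blast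
  define F where "F = (\<Union>i. C i)"
  have F_fsigma: "fsigma_in euclidean F"
    unfolding F_def using C by (intro fsigma_in_Union) (auto intro!: closed_imp_fsigma_in compact_imp_closed)
  have F: "F \<subseteq> E \<inter> P" "F \<in> sets \<nu>"
    using C EP(2) fsigma_in_borel[OF F_fsigma] by (auto simp: F_def sets_\<nu>_iff)
  have "emeasure \<nu> (E \<inter> P) \<le> emeasure \<nu> F"
    unfolding eq k(2)
  proof (rule SUP_least)
    fix i
    have "C i \<subseteq> Y" using C EP(2) by blast
    then have "k i = emeasure \<nu> (C i)"
      using C[of i] emeasure_\<nu>_borel[of "C i"] by (simp add: Int_absorb2 borel_compact)
    also have "\<dots> \<le> emeasure \<nu> F" by (rule emeasure_mono) (use F in \<open>auto simp: F_def\<close>)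
    finally show "k i \<le> emeasure \<nu> F" .
  qed
  moreover have "emeasure \<nu> (E \<inter> P) < top"
    using \<nu>.emeasure_finite[of "E \<inter> P"] by (metis infinity_ennreal_def top.not_eq_extremum)
  ultimately have "emeasure \<nu> (E \<inter> P - F) = 0"
    using emeasure_Diff[of \<nu> F "E \<inter> P"] F E P_sets \<nu>.emeasure_finite
    by (auto simp: diff_eq_0_iff_ennreal)
  then have "E \<inter> P - F \<in> null_sets \<nu>" using F E P_sets by auto
  from AE_fiber_disjoint_null[OF this]
  have "AE \<theta> in \<mu>. fiber_sum P f (indicator E) \<theta> = fiber_sum P f (indicator F) \<theta>"
  proof (rule eventually_mono)
    show "E \<inter> P - F \<subseteq> P" by auto
    fix \<theta> assume "\<forall>y\<in>E \<inter> P - F. f y \<noteq> \<theta>"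
    then show "fiber_sum P f (indicator E) \<theta> = fiber_sum P f (indicator F) \<theta>"
      using F(1) by (intro fiber_sum_cong) (auto simp: indicator_def)
  qed
  moreover have "fiber_sum P f (indicator F) \<in> borel_measurable \<mu>"
  proof (intro borel_measurable_\<mu>I borel_measurable_fiber_sum f(1))
    fix t :: ennreal
    have "{y\<in>P. t < indicator F y} = F \<or> {y\<in>P. t < indicator F y} = ({} :: 'a set)"
      using F(1) by (cases "t < 1") (auto simp: indicator_def not_less_iff_gr_or_eq)
    then show "fsigma_in euclidean {y\<in>P. t < indicator F y}" using F_fsigma by (elim disjE) (simp_all only: fsigma_in_empty)
  qed
  ultimately show ?thesis by blast
qed

text \<open>The measure \<open>\<lambda>\<^sub>k\<close> of the overview. \<open>measure_of\<close>
  takes the prescribed values only once the set function is shown to be a measure, which happens in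
  \<open>emeasure_count_measure\<close>.\<close>

definition count_measure :: "'a measure" where
  "count_measure = measure_of Y (sets \<nu>) (\<lambda>E. \<integral>\<^sup>+\<theta>. fiber_sum P f (indicator E) \<theta> \<partial>\<mu>)"

lemma sets_count_measure: "sets count_measure = sets \<nu>"
  unfolding count_measure_def using sets.sigma_sets_eq[of \<nu>] sets.space_closed[of \<nu>]
  by (simp add: space_\<nu>)

text \<open>On each fiber additivity is exact. Exchanging sum and integral over \<theta> requires
  measurable terms, so the fiber sums are first replaced by almost everywhere equal functions
  \<open>g i\<close>.\<close>

lemma emeasure_count_measure:
  assumes "E \<in> sets \<nu>"
  shows "emeasure count_measure E = (\<integral>\<^sup>+\<theta>. fiber_sum P f (indicator E) \<theta> \<partial>\<mu>)"
proof (rule emeasure_measure_of_sigma[where \<Omega>=Y and M="sets \<nu>" and \<mu>="\<lambda>E. \<integral>\<^sup>+\<theta>. fiber_sum P f (indicator E) \<theta> \<partial>\<mu>", folded count_measure_def])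
  show "sigma_algebra Y (sets \<nu>)" using sets.sigma_algebra_axioms[of \<nu>] by (simp add: space_\<nu>)
  show "positive (sets \<nu>) (\<lambda>E. \<integral>\<^sup>+\<theta>. fiber_sum P f (indicator E) \<theta> \<partial>\<mu>)"
    by (simp add: positive_def fiber_sum_def)
  show "countably_additive (sets \<nu>) (\<lambda>E. \<integral>\<^sup>+\<theta>. fiber_sum P f (indicator E) \<theta> \<partial>\<mu>)"
    unfolding countably_additive_def
  proof (intro allI impI)
    fix A :: "nat \<Rightarrow> 'a set"
    assume A: "range A \<subseteq> sets \<nu>" "disjoint_family A"
    have "\<forall>i. \<exists>g. g \<in> borel_measurable \<mu> \<and> (AE \<theta> in \<mu>. fiber_sum P f (indicator (A i)) \<theta> = g \<theta>)"
      using fiber_sum_indicator_AE_measurable A(1) by blast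
    then obtain g where g: "\<And>i. g i \<in> borel_measurable \<mu>"
      "\<And>i. AE \<theta> in \<mu>. fiber_sum P f (indicator (A i)) \<theta> = g i \<theta>" by metis
    have AE_g: "AE \<theta> in \<mu>. \<forall>i. fiber_sum P f (indicator (A i)) \<theta> = g i \<theta>"
      using g(2) by (simp add: AE_all_countable)
    have "fiber_sum P f (indicator (\<Union> (range A))) \<theta> = (\<Sum>i. fiber_sum P f (indicator (A i)) \<theta>)" for \<theta>
      unfolding fiber_sum_def
      by (subst nn_integral_suminf[symmetric]) (auto simp: suminf_indicator[OF A(2)])
    then have "(\<integral>\<^sup>+\<theta>. fiber_sum P f (indicator (\<Union> (range A))) \<theta> \<partial>\<mu>) = (\<integral>\<^sup>+\<theta>. (\<Sum>i. g i \<theta>) \<partial>\<mu>)"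
      using AE_g by (intro nn_integral_cong_AE) (auto elim!: eventually_mono)
    also have "\<dots> = (\<Sum>i. \<integral>\<^sup>+\<theta>. g i \<theta> \<partial>\<mu>)"
      by (rule nn_integral_suminf) (rule g(1))
    also have "\<dots> = (\<Sum>i. \<integral>\<^sup>+\<theta>. fiber_sum P f (indicator (A i)) \<theta> \<partial>\<mu>)"
      using nn_integral_cong_AE[OF g(2)] by simp
    finally show "(\<Sum>i. \<integral>\<^sup>+\<theta>. fiber_sum P f (indicator (A i)) \<theta> \<partial>\<mu>)
        = (\<integral>\<^sup>+\<theta>. fiber_sum P f (indicator (\<Union> (range A))) \<theta> \<partial>\<mu>)" ..
  qed
qed (rule assms)

lemma nn_integral_count_measure:
  assumes "h \<in> borel_measurable \<nu>"
  shows "(\<integral>\<^sup>+y. h y \<partial>count_measure) = (\<integral>\<^sup>+\<theta>. fiber_sum P f h \<theta> \<partial>\<mu>)"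
proof -
  have meas: "borel_measurable count_measure = borel_measurable \<nu>"
    by (rule measurable_cong_sets[OF sets_count_measure refl])
  \<comment> \<open>Integrals of nonmeasurable functions need not be additive, so the induction
    carries a measurable representative \<open>g\<close> of the fiber sum along with the
    identity.\<close>
  define Q where "Q h \<longleftrightarrow> (\<exists>g\<in>borel_measurable \<mu>. (AE \<theta> in \<mu>. fiber_sum P f h \<theta> = g \<theta>)
    \<and> (\<integral>\<^sup>+y. h y \<partial>count_measure) = (\<integral>\<^sup>+\<theta>. g \<theta> \<partial>\<mu>))" for h
  have "Q h"
    using assms
  proof (induction h rule: borel_measurable_induct)
    case (cong h h')
    have "fiber_sum P f h = fiber_sum P f h'"
      using cong(3) P(1) by (intro ext fiber_sum_cong) (auto simp: space_\<nu>)
    moreover have "(\<integral>\<^sup>+y. h y \<partial>count_measure) = (\<integral>\<^sup>+y. h' y \<partial>count_measure)"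
      using cong(3) sets_eq_imp_space_eq[OF sets_count_measure] by (intro nn_integral_cong) auto
    ultimately show ?case using cong(4) unfolding Q_def by simp
  next
    case (set E)
    obtain g where g: "g \<in> borel_measurable \<mu>" "AE \<theta> in \<mu>. fiber_sum P f (indicator E) \<theta> = g \<theta>"
      using fiber_sum_indicator_AE_measurable[OF set] by blast
    then show ?case
      using nn_integral_cong_AE[OF g(2)] set
      unfolding Q_def by (auto intro!: bexI[of _ g] simp: sets_count_measure emeasure_count_measure)
  next
    case (mult u c)
    then obtain g where g: "g \<in> borel_measurable \<mu>" "AE \<theta> in \<mu>. fiber_sum P f u \<theta> = g \<theta>"
      "(\<integral>\<^sup>+y. u y \<partial>count_measure) = (\<integral>\<^sup>+\<theta>. g \<theta> \<partial>\<mu>)" unfolding Q_def by blast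
    have "AE \<theta> in \<mu>. fiber_sum P f (\<lambda>y. c * u y) \<theta> = c * g \<theta>"
      using g(2) by eventually_elim (simp add: fiber_sum_def nn_integral_cmult)
    then show ?case
      unfolding Q_def using g(1,3) mult.hyps
      by (intro bexI[of _ "\<lambda>\<theta>. c * g \<theta>"]) (auto simp: nn_integral_cmult meas)
  next
    case (add u v)
    then obtain g g' where g: "g \<in> borel_measurable \<mu>" "AE \<theta> in \<mu>. fiber_sum P f u \<theta> = g \<theta>"
      "(\<integral>\<^sup>+y. u y \<partial>count_measure) = (\<integral>\<^sup>+\<theta>. g \<theta> \<partial>\<mu>)"
      and g': "g' \<in> borel_measurable \<mu>" "AE \<theta> in \<mu>. fiber_sum P f v \<theta> = g' \<theta>"
      "(\<integral>\<^sup>+y. v y \<partial>count_measure) = (\<integral>\<^sup>+\<theta>. g' \<theta> \<partial>\<mu>)" unfolding Q_def by blast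
    have "AE \<theta> in \<mu>. fiber_sum P f (\<lambda>y. v y + u y) \<theta> = g' \<theta> + g \<theta>"
      using g(2) g'(2) by eventually_elim (simp add: fiber_sum_def nn_integral_add)
    then show ?case
      unfolding Q_def using g(1,3) g'(1,3) add.hyps
      by (intro bexI[of _ "\<lambda>\<theta>. g' \<theta> + g \<theta>"]) (auto simp: nn_integral_add meas)
  next
    case (seq U)
    then have "\<forall>i. \<exists>g. g \<in> borel_measurable \<mu> \<and> (AE \<theta> in \<mu>. fiber_sum P f (U i) \<theta> = g \<theta>)
      \<and> (\<integral>\<^sup>+y. U i y \<partial>count_measure) = (\<integral>\<^sup>+\<theta>. g \<theta> \<partial>\<mu>)" unfolding Q_def by blast
    then obtain g where g: "\<And>i. g i \<in> borel_measurable \<mu>" "\<And>i. AE \<theta> in \<mu>. fiber_sum P f (U i) \<theta> = g i \<theta>"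
      "\<And>i. (\<integral>\<^sup>+y. U i y \<partial>count_measure) = (\<integral>\<^sup>+\<theta>. g i \<theta> \<partial>\<mu>)" by metis
    have AE_g: "AE \<theta> in \<mu>. \<forall>i. fiber_sum P f (U i) \<theta> = g i \<theta>"
      using g(2) by (simp add: AE_all_countable)
    have sup: "fiber_sum P f (SUP i. U i) \<theta> = (SUP i. fiber_sum P f (U i) \<theta>)" for \<theta>
      unfolding fiber_sum_def SUP_apply
      by (rule nn_integral_monotone_convergence_SUP) (use seq in auto)
    have "AE \<theta> in \<mu>. fiber_sum P f (SUP i. U i) \<theta> = (SUP i. g i \<theta>)"
      using AE_g by eventually_elim (simp add: sup)
    moreover have "(\<integral>\<^sup>+y. (SUP i. U i) y \<partial>count_measure) = (\<integral>\<^sup>+\<theta>. (SUP i. g i \<theta>) \<partial>\<mu>)"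
    proof -
      have "(\<integral>\<^sup>+y. (SUP i. U i) y \<partial>count_measure) = (SUP i. \<integral>\<^sup>+y. U i y \<partial>count_measure)"
        unfolding SUP_apply by (rule nn_integral_monotone_convergence_SUP) (use seq meas in auto)
      also have "\<dots> = (SUP i. \<integral>\<^sup>+\<theta>. g i \<theta> \<partial>\<mu>)" using g(3) by simp
      also have "\<dots> = (\<integral>\<^sup>+\<theta>. (SUP i. g i \<theta>) \<partial>\<mu>)"
      \<comment> \<open>The representatives inherit monotonicity from the fiber sums only almost
        everywhere.\<close>
      proof (rule nn_integral_monotone_convergence_SUP_AE[symmetric])
        fix i
        show "AE \<theta> in \<mu>. g i \<theta> \<le> g (Suc i) \<theta>"
          using AE_g
        proof eventually_elim
          fix \<theta> assume "\<forall>i. fiber_sum P f (U i) \<theta> = g i \<theta>"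
          moreover have "fiber_sum P f (U i) \<theta> \<le> fiber_sum P f (U (Suc i)) \<theta>"
            using incseq_SucD[OF \<open>incseq U\<close>, of i] by (intro fiber_sum_mono) (simp add: le_fun_def)
          ultimately show "g i \<theta> \<le> g (Suc i) \<theta>" by simp
        qed
      qed (rule g(1))
      finally show ?thesis .
    qed
    moreover have "(\<lambda>\<theta>. SUP i. g i \<theta>) \<in> borel_measurable \<mu>" using g(1) by measurable
    ultimately show ?case
      unfolding Q_def by (intro bexI[of _ "\<lambda>\<theta>. SUP i. g i \<theta>"] conjI)
  qed
  then obtain g where "AE \<theta> in \<mu>. fiber_sum P f h \<theta> = g \<theta>"
    "(\<integral>\<^sup>+y. h y \<partial>count_measure) = (\<integral>\<^sup>+\<theta>. g \<theta> \<partial>\<mu>)" unfolding Q_def by blast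
  then show ?thesis using nn_integral_cong_AE by metis
qed

lemma absolutely_continuous_count_measure: "absolutely_continuous \<nu> count_measure"
  unfolding absolutely_continuous_def
proof
  fix N assume N: "N \<in> null_sets \<nu>"
  then have "N \<inter> P \<in> null_sets \<nu>" using null_set_Int2[OF N P_sets] by simp
  from AE_fiber_disjoint_null[OF this] have "AE \<theta> in \<mu>. fiber_sum P f (indicator N) \<theta> = 0"
  proof (rule eventually_mono)
    fix \<theta> assume "\<forall>y\<in>N \<inter> P. f y \<noteq> \<theta>"
    then show "fiber_sum P f (indicator N) \<theta> = 0"
      by (intro fiber_sum_eq_0) (auto simp: indicator_def)
  qed auto
  then have "emeasure count_measure N = 0"
    using N by (simp add: emeasure_count_measure null_setsD2 nn_integral_0_iff_AE nn_integral_cong_AE)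
  then show "N \<in> null_sets count_measure" using N by (auto simp: null_sets_def sets_count_measure)
qed

text \<open>The set where the fibers through \<open>K\<close> have at most \<open>n\<close> points has measure at most
  \<open>n \<mu>(\<Theta>)\<close>.\<close>

lemma sigma_finite_count_measure: "sigma_finite_measure count_measure"
proof
  define c where "c K \<theta> = emeasure (count_space UNIV) {y\<in>K. f y = \<theta>}" for K :: "'a set" and \<theta>
  define E where "E K n = {y\<in>K. c K (f y) \<le> of_nat n}" for K and n :: nat
  define E' where "E' K = {y\<in>K. c K (f y) = \<infinity>}" for K
  have meas: "E K n \<in> sets \<nu>" "E' K \<in> sets \<nu>" if "K \<in> \<K>" for K n
  proof -
    have K: "K \<subseteq> P" "fsigma_in euclidean K" using \<K>(3)[OF that] by auto
    have fK: "continuous_on K f" using f(1) K(1) by (rule continuous_on_subset)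
    have "fiber_sum K f (\<lambda>_. 1) \<in> borel_measurable borel"
    proof (rule borel_measurable_fiber_sum[OF fK])
      fix t :: ennreal show "fsigma_in euclidean {y\<in>K. t < 1}" using K(2) by (cases "t < 1") auto
    qed
    moreover have "fiber_sum K f (\<lambda>_. 1) = c K"
    proof
      fix \<theta>
      have "fiber_sum K f (\<lambda>_. 1) \<theta> = fiber_sum K f (indicator K) \<theta>" by (rule fiber_sum_cong) simp
      then show "fiber_sum K f (\<lambda>_. 1) \<theta> = c K \<theta>"
        unfolding c_def fiber_sum_indicator[OF subset_refl] .
    qed
    ultimately have [measurable]: "c K \<in> borel_measurable borel" by simp
    have [measurable]: "f \<in> borel_measurable (restrict_space borel K)"
      using fK by (rule borel_measurable_continuous_on_restrict)
    have "{y\<in>space (restrict_space borel K). c K (f y) \<le> of_nat n} \<in> sets (restrict_space borel K)"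
      "{y\<in>space (restrict_space borel K). c K (f y) = \<infinity>} \<in> sets (restrict_space borel K)"
      by measurable
    then show "E K n \<in> sets \<nu>" "E' K \<in> sets \<nu>"
      using fsigma_in_borel[OF K(2)] K(1) P(1)
      by (auto simp: E_def E'_def sets_\<nu>_iff sets_restrict_space_iff space_restrict_space)
  qed
  \<comment> \<open>Three kinds of sets: nothing is counted off \<open>P\<close>; counts on
    \<open>E K n\<close> are at most \<open>n\<close>; and \<open>E' K\<close> meets only infinite
    fibers through \<open>K\<close>, which occur over a null set.\<close>
  define \<A> where "\<A> = insert (Y - P) ((\<Union>K\<in>\<K>. range (E K)) \<union> E' ` \<K>)"
  have "countable \<A>" using \<K>(1) by (auto simp: \<A>_def)
  moreover have "\<A> \<subseteq> sets count_measure"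
    using meas P_sets space_\<nu> by (auto simp: \<A>_def sets_count_measure)
  moreover have "\<Union>\<A> = space count_measure"
  proof -
    have "y \<in> \<Union>\<A>" if "y \<in> Y" for y
    proof (cases "y \<in> P")
      case True
      then obtain K where K: "K \<in> \<K>" "y \<in> K" using \<K>(2) by blast
      show ?thesis
      proof (cases "c K (f y) = \<infinity>")
        case False
        then obtain n where "c K (f y) < of_nat n"
          using ennreal_Ex_less_of_nat by (auto simp: less_top)
        then have "y \<in> E K n" using K(2) by (simp add: E_def)
        then show ?thesis using K(1) by (auto simp: \<A>_def)
      qed (use K in \<open>auto simp: \<A>_def E'_def\<close>)
    qed (use that in \<open>auto simp: \<A>_def\<close>)
    moreover have "\<Union>\<A> \<subseteq> Y" using meas by (fastforce simp: \<A>_def sets_\<nu>_iff)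
    ultimately show ?thesis
      using sets_eq_imp_space_eq[OF sets_count_measure] by (auto simp: space_\<nu>)
  qed
  moreover have "emeasure count_measure a \<noteq> \<infinity>" if "a \<in> \<A>" for a
    using that unfolding \<A>_def
  proof (elim insertE UnE UN_E imageE)
    assume a: "a = Y - P"
    then have "a \<in> sets \<nu>" using P_sets space_\<nu> by auto
    have "fiber_sum P f (indicator a) \<theta> = 0" for \<theta>
      by (intro fiber_sum_eq_0) (auto simp: a indicator_def)
    then have "(\<integral>\<^sup>+\<theta>. fiber_sum P f (indicator a) \<theta> \<partial>\<mu>) = (\<integral>\<^sup>+\<theta>. 0 \<partial>\<mu>)" by (intro nn_integral_cong)
    then show ?thesis using emeasure_count_measure[OF \<open>a \<in> sets \<nu>\<close>] by simp
  next
    fix K n assume K: "K \<in> \<K>" and a: "a = E K n"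
    have KP: "K \<subseteq> P" using \<K>(3)[OF K] by auto
    have "fiber_sum P f (indicator a) \<theta> \<le> of_nat n" for \<theta>
    proof (cases "\<exists>y\<in>a. f y = \<theta>")
      case True
      then obtain y where "y \<in> E K n" "f y = \<theta>" using a by auto
      then have "c K \<theta> \<le> of_nat n" by (auto simp: E_def)
      moreover have "emeasure (count_space UNIV) {y\<in>a. f y = \<theta>} \<le> c K \<theta>"
        unfolding c_def a E_def by (rule emeasure_mono) auto
      moreover have "fiber_sum P f (indicator a) \<theta> = emeasure (count_space UNIV) {y\<in>a. f y = \<theta>}"
        by (rule fiber_sum_indicator) (use KP a in \<open>auto simp: E_def\<close>)
      ultimately show ?thesis by simp
    next
      case False
      then have "fiber_sum P f (indicator a) \<theta> = 0"
        by (intro fiber_sum_eq_0) (auto simp: indicator_def)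
      then show ?thesis by simp
    qed
    then have "(\<integral>\<^sup>+\<theta>. fiber_sum P f (indicator a) \<theta> \<partial>\<mu>) \<le> (\<integral>\<^sup>+\<theta>. of_nat n \<partial>\<mu>)"
      by (intro nn_integral_mono)
    then have "emeasure count_measure a \<le> (\<integral>\<^sup>+\<theta>. of_nat n \<partial>\<mu>)"
      using meas(1)[OF K] a by (simp only: emeasure_count_measure)
    also have "\<dots> < \<infinity>"
    proof -
      have "emeasure \<mu> (space \<mu>) < top"
        using \<mu>.emeasure_finite[of "space \<mu>"] by (metis infinity_ennreal_def top.not_eq_extremum)
      then show ?thesis by (simp add: ennreal_mult_less_top of_nat_less_top)
    qed
    finally show ?thesis by simp
  next
    fix K assume K: "K \<in> \<K>" and a: "a = E' K"
    have KP: "K \<subseteq> P" and "AE \<theta> in \<mu>. finite {y\<in>K. f y = \<theta>}" using \<K>(3)[OF K] by auto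
    from this(2) have "AE \<theta> in \<mu>. fiber_sum P f (indicator a) \<theta> = 0"
    proof eventually_elim
      fix \<theta> assume "finite {y\<in>K. f y = \<theta>}"
      then have "c K \<theta> \<noteq> \<infinity>" by (simp add: c_def)
      then show "fiber_sum P f (indicator a) \<theta> = 0"
        by (intro fiber_sum_eq_0) (auto simp: a E'_def indicator_def)
    qed
    then have "(\<integral>\<^sup>+\<theta>. fiber_sum P f (indicator a) \<theta> \<partial>\<mu>) = (\<integral>\<^sup>+\<theta>. 0 \<partial>\<mu>)" by (rule nn_integral_cong_AE)
    then show ?thesis using emeasure_count_measure[of a] meas(2)[OF K] a by simp
  qed
  ultimately show "\<exists>A. countable A \<and> A \<subseteq> sets count_measure \<and> \<Union>A = space count_measure \<and>
      (\<forall>a\<in>A. emeasure count_measure a \<noteq> \<infinity>)"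
    by (intro exI[of _ \<A>] conjI ballI)
qed

text \<open>Sigma-finiteness makes the Radon-Nikodym derivative finite almost everywhere, so passing
  to a real-valued density loses nothing. Fiber sums see only points of \<open>P\<close>, so the
  density may be set to zero elsewhere.\<close>

lemma fiber_density:
  obtains r :: "'a \<Rightarrow> real" where "r \<in> borel_measurable \<nu>" "\<And>y. r y \<ge> 0" "\<And>y. y \<notin> P \<Longrightarrow> r y = 0"
    "\<And>h. h \<in> borel_measurable \<nu> \<Longrightarrow> (\<integral>\<^sup>+\<theta>. fiber_sum P f h \<theta> \<partial>\<mu>) = (\<integral>\<^sup>+y. h y * ennreal (r y) \<partial>\<nu>)"
proof
  let ?D = "RN_deriv \<nu> count_measure"
  define r where "r y = indicator P y * enn2real (?D y)" for y
  show "r \<in> borel_measurable \<nu>" unfolding r_def using P_sets by measurable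
  show "r y \<ge> 0" for y by (simp add: r_def)
  show "r y = 0" if "y \<notin> P" for y using that by (simp add: r_def)
  fix h :: "'a \<Rightarrow> ennreal" assume h [measurable]: "h \<in> borel_measurable \<nu>"
  have [measurable]: "P \<in> sets \<nu>" by (rule P_sets)
  have finD: "AE y in \<nu>. ?D y \<noteq> \<infinity>"
    by (rule \<nu>.RN_deriv_finite[OF sigma_finite_count_measure absolutely_continuous_count_measure sets_count_measure])
  have "(\<integral>\<^sup>+\<theta>. fiber_sum P f h \<theta> \<partial>\<mu>) = (\<integral>\<^sup>+\<theta>. fiber_sum P f (\<lambda>y. h y * indicator P y) \<theta> \<partial>\<mu>)"
    by (intro nn_integral_cong fiber_sum_cong) simp
  also have "\<dots> = (\<integral>\<^sup>+y. h y * indicator P y \<partial>count_measure)"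
    by (rule nn_integral_count_measure[symmetric]) measurable
  also have "\<dots> = (\<integral>\<^sup>+y. ?D y * (h y * indicator P y) \<partial>\<nu>)"
    by (rule \<nu>.RN_deriv_nn_integral[OF absolutely_continuous_count_measure sets_count_measure]) measurable
  also have "\<dots> = (\<integral>\<^sup>+y. h y * ennreal (r y) \<partial>\<nu>)"
    using finD by (intro nn_integral_cong_AE)
      (auto elim!: eventually_mono simp: r_def indicator_def less_top mult.commute)
  finally show "(\<integral>\<^sup>+\<theta>. fiber_sum P f h \<theta> \<partial>\<mu>) = (\<integral>\<^sup>+y. h y * ennreal (r y) \<partial>\<nu>)" .
qed

end

section \<open>Null sets of manifolds\<close>

lemma is_chartE:
  assumes "is_chart d M A B U \<phi>"
  obtains \<psi> where "A \<subseteq> Basis" "card A = d" "openin (top_of_set M) U"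
    "homeomorphism U (\<phi> ` U) \<phi> \<psi>" "locally_Lipschitz_on U \<phi>" "locally_Lipschitz_on (\<phi> ` U) \<psi>"
    "\<And>x. x \<in> U \<Longrightarrow> coord_proj A (\<phi> x) = \<phi> x"
proof -
  obtain \<psi> where \<psi>: "diffeomorphism U (\<phi> ` U) \<phi> \<psi>" using assms unfolding is_chart_def by blast
  have A: "A \<subseteq> Basis" using assms unfolding is_chart_def by blast
  have "\<phi> ` U \<subseteq> corner_model A B" using assms unfolding is_chart_def by (meson openin_imp_subset)
  then have "coord_proj A (\<phi> x) = \<phi> x" if "x \<in> U" for x
    using that corner_model_coord_proj[OF A] by blast
  then show ?thesis
    using that[of \<psi>] \<psi> A assms C1_on_imp_locally_Lipschitz_on
    unfolding is_chart_def diffeomorphism_def by blast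
qed

lemma openin_regular_points: "openin (top_of_set M) (regular_points d M)"
proof -
  have "regular_points d M = \<Union>{U. \<exists>A B \<phi>. is_chart d M A B U \<phi>}"
    unfolding regular_points_def by blast
  also have "openin (top_of_set M) \<dots>" unfolding is_chart_def by (rule openin_Union) blast
  finally show ?thesis .
qed

lemma countable_chart_cover:
  obtains \<U> where "countable \<U>" "\<forall>U\<in>\<U>. \<exists>A B \<phi>. is_chart d M A B U \<phi>" "\<Union>\<U> = regular_points d M"
proof -
  define \<F> where "\<F> = {U. \<exists>A B \<phi>. is_chart d M A B U \<phi>}"
  have "openin (top_of_set M) U" if "U \<in> \<F>" for U using that unfolding \<F>_def is_chart_def by blast
  then obtain \<U> where "\<U> \<subseteq> \<F>" "countable \<U>" "\<Union>\<U> = \<Union>\<F>" by (rule Lindelof_openin)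
  moreover have "\<Union>\<F> = regular_points d M" unfolding \<F>_def regular_points_def by blast
  ultimately show ?thesis using that[of \<U>] unfolding \<F>_def by blast
qed

lemma lebesgue_null_iff:
  "lebesgue_null d M N \<longleftrightarrow>
     (\<forall>A B U \<phi>. is_chart d M A B U \<phi> \<longrightarrow> negligible {x. coord_proj A x \<in> \<phi> ` (N \<inter> U)})"
  by (simp add: lebesgue_null_def coord_proj_def)

text \<open>Charts consist of regular points, so inclusion need only be checked there.\<close>

lemma lebesgue_null_subset:
  assumes "lebesgue_null d M N" "N' \<inter> regular_points d M \<subseteq> N"
  shows "lebesgue_null d M N'"
  unfolding lebesgue_null_iff
proof (intro allI impI)
  fix A B U \<phi> assume ch: "is_chart d M A B U \<phi>"
  then have "U \<subseteq> regular_points d M" unfolding regular_points_def by blast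
  then have "{x. coord_proj A x \<in> \<phi> ` (N' \<inter> U)} \<subseteq> {x. coord_proj A x \<in> \<phi> ` (N \<inter> U)}"
    using assms(2) by blast
  moreover have "negligible {x. coord_proj A x \<in> \<phi> ` (N \<inter> U)}"
    using assms(1) ch unfolding lebesgue_null_iff by blast
  ultimately show "negligible {x. coord_proj A x \<in> \<phi> ` (N' \<inter> U)}" using negligible_subset by blast
qed

lemma lebesgue_null_singular:
  assumes "N \<inter> regular_points d M = {}"
  shows "lebesgue_null d M N"
proof -
  have "lebesgue_null d M {}" by (simp add: lebesgue_null_iff)
  then show ?thesis by (rule lebesgue_null_subset) (use assms in auto)
qed

lemma lebesgue_null_Union:
  assumes "countable \<N>" "\<And>N. N \<in> \<N> \<Longrightarrow> lebesgue_null d M N"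
  shows "lebesgue_null d M (\<Union>\<N>)"
  unfolding lebesgue_null_iff
proof (intro allI impI)
  fix A B U \<phi> assume ch: "is_chart d M A B U \<phi>"
  have "negligible (\<Union>N\<in>\<N>. {x. coord_proj A x \<in> \<phi> ` (N \<inter> U)})"
    by (rule negligible_countable_Union) (use assms ch lebesgue_null_iff in blast)+
  moreover have "{x. coord_proj A x \<in> \<phi> ` (\<Union>\<N> \<inter> U)} = (\<Union>N\<in>\<N>. {x. coord_proj A x \<in> \<phi> ` (N \<inter> U)})"
    by blast
  ultimately show "negligible {x. coord_proj A x \<in> \<phi> ` (\<Union>\<N> \<inter> U)}" by simp
qed

text \<open>In coordinates \<open>g\<close> becomes \<open>\<phi>' \<circ> g \<circ> \<psi>\<close>,
  a locally Lipschitz map between cylinder bases. The alternative \<open>e < m\<close> treats pieces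
  of lower dimension, where \<open>N\<close> itself may be arbitrary.\<close>

lemma lebesgue_null_image_chart:
  fixes g :: "'a::euclidean_space \<Rightarrow> 'b::euclidean_space"
  assumes ch: "is_chart e M A B U \<phi>" and N: "N \<subseteq> U"
    and g: "locally_Lipschitz_on N g"
    and dim: "e < m \<or> e = m \<and> negligible {x. coord_proj A x \<in> \<phi> ` N}"
  shows "lebesgue_null m \<Theta> (g ` N)"
  unfolding lebesgue_null_iff
proof (intro allI impI)
  fix A' B' U' \<phi>' assume ch': "is_chart m \<Theta> A' B' U' \<phi>'"
  obtain \<psi> where A: "A \<subseteq> Basis" "card A = e" and hom: "homeomorphism U (\<phi> ` U) \<phi> \<psi>"
    and \<psi>: "locally_Lipschitz_on (\<phi> ` U) \<psi>" and proj: "\<And>x. x \<in> U \<Longrightarrow> coord_proj A (\<phi> x) = \<phi> x"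
    using is_chartE[OF ch] by metis
  obtain \<psi>' where A': "A' \<subseteq> Basis" "card A' = m" and \<phi>': "locally_Lipschitz_on U' \<phi>'"
    using is_chartE[OF ch'] by metis
  define N' where "N' = {x\<in>N. g x \<in> U'}"
  have \<psi>\<phi>: "\<psi> (\<phi> x) = x" if "x \<in> N'" for x
    using that N homeomorphism_apply1[OF hom] by (auto simp: N'_def)
  have "locally_Lipschitz_on (\<phi> ` N') (\<lambda>s. g (\<psi> s))"
    by (rule locally_Lipschitz_on_compose[OF locally_Lipschitz_on_subset[OF \<psi>] g])
       (use N \<psi>\<phi> in \<open>auto simp: N'_def\<close>)
  then have h: "locally_Lipschitz_on (\<phi> ` N') (\<lambda>s. \<phi>' (g (\<psi> s)))"
    by (rule locally_Lipschitz_on_compose[OF _ \<phi>']) (use \<psi>\<phi> in \<open>auto simp: N'_def\<close>)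
  have "negligible {v. coord_proj A' v \<in> (\<lambda>s. \<phi>' (g (\<psi> s))) ` \<phi> ` N'}"
  proof (rule negligible_cylinder_image[OF A(1) A'(1) _ h])
    show "coord_proj A s = s" if "s \<in> \<phi> ` N'" for s using that N proj by (auto simp: N'_def)
    have "{x. coord_proj A x \<in> \<phi> ` N'} \<subseteq> {x. coord_proj A x \<in> \<phi> ` N}" by (auto simp: N'_def)
    from negligible_subset[OF _ this]
    show "card A < card A' \<or> card A = card A' \<and> negligible {x. coord_proj A x \<in> \<phi> ` N'}"
      using dim A(2) A'(2) by auto
  qed
  moreover have "(\<lambda>s. \<phi>' (g (\<psi> s))) ` \<phi> ` N' = \<phi>' ` (g ` N \<inter> U')"
  proof -
    have "(\<lambda>s. \<phi>' (g (\<psi> s))) ` \<phi> ` N' = (\<lambda>x. \<phi>' (g x)) ` N'"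
      unfolding image_image using \<psi>\<phi> by (intro image_cong) auto
    also have "\<dots> = \<phi>' ` (g ` N \<inter> U')" by (auto simp: N'_def)
    finally show ?thesis .
  qed
  ultimately show "negligible {x. coord_proj A' x \<in> \<phi>' ` (g ` N \<inter> U')}" by simp
qed

text \<open>\<open>lebesgue_null\<close> carries no information about singular points of
  \<open>Y\<close>. Their images are null because they lie in countably many manifolds of dimension
  less than \<open>m\<close>; \<open>piece\<close> treats these and the regular part alike.\<close>

lemma lebesgue_null_image:
  fixes g :: "'a::euclidean_space \<Rightarrow> 'b::euclidean_space"
  assumes Y: "compact_manifold m Y" and N: "lebesgue_null m Y N" "N \<subseteq> Y"
    and g: "locally_Lipschitz_on N g"
  shows "lebesgue_null m \<Theta> (g ` N)"
proof -
  obtain \<M> where \<M>: "countable \<M>" "Y - regular_points m Y \<subseteq> \<Union>\<M>"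
    "\<forall>M\<in>\<M>. \<exists>e<m. regular_points e M = M"
    using Y unfolding compact_manifold_def lower_dimensional_def by blast
  have piece: "lebesgue_null m \<Theta> (g ` (N \<inter> regular_points e M))"
    if "e < m \<or> e = m \<and> M = Y" for e M
  proof -
    obtain \<U> where \<U>: "countable \<U>" "\<forall>U\<in>\<U>. \<exists>A B \<phi>. is_chart e M A B U \<phi>" "\<Union>\<U> = regular_points e M"
      by (rule countable_chart_cover)
    have "lebesgue_null m \<Theta> (\<Union>((\<lambda>U. g ` (N \<inter> U)) ` \<U>))"
    proof (rule lebesgue_null_Union)
      fix R assume "R \<in> (\<lambda>U. g ` (N \<inter> U)) ` \<U>"
      then obtain U A B \<phi> where R: "R = g ` (N \<inter> U)" and ch: "is_chart e M A B U \<phi>" using \<U>(2) by blast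
      show "lebesgue_null m \<Theta> R"
        unfolding R
      proof (rule lebesgue_null_image_chart[OF ch _ locally_Lipschitz_on_subset[OF g]])
        show "e < m \<or> e = m \<and> negligible {x. coord_proj A x \<in> \<phi> ` (N \<inter> U)}"
          using that ch N(1) unfolding lebesgue_null_iff by blast
      qed auto
    qed (use \<U>(1) in auto)
    moreover have "\<Union>((\<lambda>U. g ` (N \<inter> U)) ` \<U>) = g ` (N \<inter> regular_points e M)" using \<U>(3) by blast
    ultimately show ?thesis by simp
  qed
  have "lebesgue_null m \<Theta> (\<Union>(insert (g ` (N \<inter> regular_points m Y)) ((\<lambda>M. g ` (N \<inter> M)) ` \<M>)))"
  proof (rule lebesgue_null_Union)
    fix R assume "R \<in> insert (g ` (N \<inter> regular_points m Y)) ((\<lambda>M. g ` (N \<inter> M)) ` \<M>)"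
    then show "lebesgue_null m \<Theta> R"
    proof
      assume "R = g ` (N \<inter> regular_points m Y)"
      then show ?thesis using piece by blast
    next
      assume "R \<in> (\<lambda>M. g ` (N \<inter> M)) ` \<M>"
      then obtain M e where "R = g ` (N \<inter> M)" "e < m" "regular_points e M = M" using \<M>(3) by blast
      then show ?thesis using piece[of e M] by simp
    qed
  qed (use \<M>(1) in auto)
  moreover have "g ` N \<subseteq> \<Union>(insert (g ` (N \<inter> regular_points m Y)) ((\<lambda>M. g ` (N \<inter> M)) ` \<M>))"
  proof
    fix \<theta> assume "\<theta> \<in> g ` N"
    then obtain x where x: "x \<in> N" "\<theta> = g x" by blast
    show "\<theta> \<in> \<Union>(insert (g ` (N \<inter> regular_points m Y)) ((\<lambda>M. g ` (N \<inter> M)) ` \<M>))"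
    proof (cases "x \<in> regular_points m Y")
      case False
      then obtain M where "M \<in> \<M>" "x \<in> M" using \<M>(2) N(2) x(1) by blast
      then show ?thesis using x by auto
    qed (use x in auto)
  qed
  ultimately show ?thesis by (rule lebesgue_null_subset[OF _ order_trans[OF Int_lower1]])
qed

lemma openin_preimage_trans:
  assumes "openin (top_of_set Y) R" "continuous_on R k" "k ` R \<subseteq> Q" "openin (top_of_set Q) O'"
  shows "openin (top_of_set Y) {x\<in>R. k x \<in> O'}"
proof -
  have "openin (top_of_set R) (R \<inter> k -` O')"
    using assms(2,4,3) by (intro continuous_openin_preimage[of R k Q]) auto
  then have "openin (top_of_set Y) (R \<inter> k -` O')" using assms(1) openin_trans by blast
  then show ?thesis by (simp add: vimage_def Int_def)
qed

text \<open>The closed ball is chosen so small that its part in \<open>Y\<close> lies in one chart,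
  is mapped into one chart of \<Theta>, and admits a single Lipschitz constant in coordinates. This
  part is compact, so the cube counting argument applies.\<close>

lemma locally_finite_fibers:
  fixes g :: "'a::euclidean_space \<Rightarrow> 'b::euclidean_space"
  assumes "closed Y" and P: "openin (top_of_set Y) P"
    and g: "locally_Lipschitz_on P g" "g ` P \<subseteq> \<Theta>"
    and y: "y \<in> P" "y \<in> regular_points m Y" "g y \<in> regular_points m \<Theta>"
  obtains \<delta> where "\<delta> > 0" "Y \<inter> cball y \<delta> \<subseteq> P"
    "lebesgue_null m \<Theta> {\<theta>. infinite {z \<in> Y \<inter> cball y \<delta>. g z = \<theta>}}"
proof -
  obtain A B U \<phi> where ch: "is_chart m Y A B U \<phi>" and yU: "y \<in> U"
    using y(2) unfolding regular_points_def by blast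
  obtain A' B' U' \<phi>' where ch': "is_chart m \<Theta> A' B' U' \<phi>'" and yU': "g y \<in> U'"
    using y(3) unfolding regular_points_def by blast
  obtain \<psi> where A: "A \<subseteq> Basis" "card A = m" and U: "openin (top_of_set Y) U"
    and hom: "homeomorphism U (\<phi> ` U) \<phi> \<psi>"
    and \<psi>: "locally_Lipschitz_on (\<phi> ` U) \<psi>" and proj: "\<And>x. x \<in> U \<Longrightarrow> coord_proj A (\<phi> x) = \<phi> x"
    using is_chartE[OF ch] by metis
  obtain \<psi>' where A': "A' \<subseteq> Basis" "card A' = m" and U': "openin (top_of_set \<Theta>) U'"
    and \<phi>': "locally_Lipschitz_on U' \<phi>'"
    using is_chartE[OF ch'] by metis
  have \<psi>\<phi>: "\<psi> (\<phi> x) = x" if "x \<in> U" for x using that homeomorphism_apply1[OF hom] by blast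
  have cont\<phi>: "continuous_on U \<phi>" using hom by (rule homeomorphism_cont1)
  define V where "V = U \<inter> {x\<in>P. g x \<in> U'}"
  have V: "openin (top_of_set Y) V" "V \<subseteq> U" "V \<subseteq> P" "y \<in> V"
    unfolding V_def using yU yU' y(1)
    by (auto intro!: openin_Int U openin_preimage_trans[OF P locally_Lipschitz_on_imp_continuous_on[OF g(1)] g(2) U'])
  have \<psi>\<phi>V: "\<psi> (\<phi> x) = x" if "x \<in> V" for x using that \<psi>\<phi> V(2) by blast
  have "locally_Lipschitz_on (\<phi> ` V) (\<lambda>s. g (\<psi> s))"
    by (rule locally_Lipschitz_on_compose[OF locally_Lipschitz_on_subset[OF \<psi>] g(1)])
       (use V(2,3) \<psi>\<phi>V in auto)
  then have "locally_Lipschitz_on (\<phi> ` V) (\<lambda>s. \<phi>' (g (\<psi> s)))"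
    by (rule locally_Lipschitz_on_compose[OF _ \<phi>']) (use \<psi>\<phi>V in \<open>auto simp: V_def\<close>)
  then obtain W L where W: "open W" "\<phi> y \<in> W" "L-lipschitz_on (W \<inter> \<phi> ` V) (\<lambda>s. \<phi>' (g (\<psi> s)))"
    using V(4) unfolding locally_Lipschitz_on_def by blast
  define V' where "V' = {x\<in>V. \<phi> x \<in> W}"
  have "openin (top_of_set Y) V'"
    unfolding V'_def
    by (rule openin_preimage_trans[OF V(1) continuous_on_subset[OF cont\<phi> V(2)], of UNIV]) (use W(1) in auto)
  moreover have "y \<in> V'" using V(4) W(2) by (simp add: V'_def)
  ultimately obtain \<delta> where \<delta>: "\<delta> > 0" "cball y \<delta> \<inter> Y \<subseteq> V'"
    by (metis openin_contains_cball)
  define K where "K = Y \<inter> cball y \<delta>"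
  have K: "K \<subseteq> V'" "K \<subseteq> V" "K \<subseteq> U" using \<delta>(2) V(2) by (auto simp: K_def V'_def)
  have "compact K" unfolding K_def using \<open>closed Y\<close> by (intro closed_Int_compact) auto
  define D where "D = {\<theta>. infinite {z\<in>K. g z = \<theta>}}"
  have "D \<subseteq> U'"
  proof
    fix \<theta> assume "\<theta> \<in> D"
    then have "{z\<in>K. g z = \<theta>} \<noteq> {}" unfolding D_def by (metis (mono_tags, lifting) finite.emptyI mem_Collect_eq)
    then show "\<theta> \<in> U'" using K(2) by (auto simp: V_def)
  qed
  have "negligible {v. infinite {s\<in>\<phi> ` K. \<phi>' (g (\<psi> s)) = coord_proj A' v}}"
  proof (rule negligible_infinite_fibers[OF A(1) A'(1)])
    show "card A = card A'" using A A' by simp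
    show "compact (\<phi> ` K)"
      by (rule compact_continuous_image[OF continuous_on_subset[OF cont\<phi> K(3)] \<open>compact K\<close>])
    show "coord_proj A s = s" if "s \<in> \<phi> ` K" for s using that K(3) proj by auto
    show "L-lipschitz_on (\<phi> ` K) (\<lambda>s. \<phi>' (g (\<psi> s)))"
      using W(3) by (rule lipschitz_on_subset) (use K(1,2) in \<open>auto simp: V'_def\<close>)
  qed
  moreover have "{v. coord_proj A' v \<in> \<phi>' ` D} \<subseteq> {v. infinite {s\<in>\<phi> ` K. \<phi>' (g (\<psi> s)) = coord_proj A' v}}"
  proof
    fix v assume "v \<in> {v. coord_proj A' v \<in> \<phi>' ` D}"
    then obtain \<theta> where \<theta>: "\<theta> \<in> D" "coord_proj A' v = \<phi>' \<theta>" by auto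
    have "inj_on \<phi> {z\<in>K. g z = \<theta>}" using K(3) \<psi>\<phi> by (intro inj_on_inverseI[of _ \<psi>]) auto
    then have "infinite (\<phi> ` {z\<in>K. g z = \<theta>})" using \<theta>(1) finite_imageD unfolding D_def by blast
    moreover have "\<phi> ` {z\<in>K. g z = \<theta>} \<subseteq> {s\<in>\<phi> ` K. \<phi>' (g (\<psi> s)) = coord_proj A' v}"
    proof
      fix s assume "s \<in> \<phi> ` {z\<in>K. g z = \<theta>}"
      then obtain z where z: "z \<in> K" "g z = \<theta>" "s = \<phi> z" by blast
      then have "\<psi> s = z" using K(3) \<psi>\<phi> by auto
      then show "s \<in> {s\<in>\<phi> ` K. \<phi>' (g (\<psi> s)) = coord_proj A' v}" using z \<theta>(2) by simp
    qed
    ultimately show "v \<in> {v. infinite {s\<in>\<phi> ` K. \<phi>' (g (\<psi> s)) = coord_proj A' v}}"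
      using finite_subset by blast
  qed
  ultimately have "negligible {v. coord_proj A' v \<in> \<phi>' ` D}" by (rule negligible_subset)
  \<comment> \<open>\<open>D\<close> is null in the single chart \<open>\<phi>'\<close>, while
    \<open>lebesgue_null\<close> asks for all charts. The image lemma for the identity map supplies
    the change of charts.\<close>
  then have "lebesgue_null m \<Theta> ((\<lambda>\<theta>. \<theta>) ` D)"
    using lebesgue_null_image_chart[OF ch' \<open>D \<subseteq> U'\<close>, of "\<lambda>\<theta>. \<theta>" m \<Theta>]
      bounded_linear_imp_locally_Lipschitz_on[OF bounded_linear_ident] by blast
  then show ?thesis
    using that[OF \<delta>(1)] K V(3) unfolding D_def K_def by auto
qed

lemma lebesgue_class_null_sets_iff:
  assumes "lebesgue_class d M \<mu>" "N \<in> sets \<mu>"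
  shows "N \<in> null_sets \<mu> \<longleftrightarrow> lebesgue_null d M N"
  using assms unfolding lebesgue_class_def null_sets_def by blast

text \<open>Where \<open>y\<close> and \<open>g y\<close> are both regular, small compact balls have
  finite fibers almost everywhere, and by Lindelof countably many of them suffice. The remaining set
  \<open>P - R\<close> has null image, so almost every fiber misses it.\<close>

lemma exists_fiber_counting:
  fixes g :: "'a::euclidean_space \<Rightarrow> 'b::euclidean_space"
  assumes Y: "compact_manifold m Y" and \<Theta>: "compact_manifold m \<Theta>"
    and "finite_measure \<mu>" and \<mu>: "lebesgue_class m \<Theta> \<mu>"
    and "finite_measure \<nu>" and \<nu>: "lebesgue_class m Y \<nu>"
    and P: "openin (top_of_set Y) P" and g: "locally_Lipschitz_on P g" "g ` P \<subseteq> \<Theta>"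
  shows "\<exists>\<K>. fiber_counting \<mu> \<nu> \<Theta> Y P g \<K>"
proof -
  have closed: "closed Y" "closed \<Theta>"
    using Y \<Theta> compact_imp_closed unfolding compact_manifold_def by blast+
  have sets: "sets \<mu> = sets (restrict_space borel \<Theta>)" "sets \<nu> = sets (restrict_space borel Y)"
    using \<mu> \<nu> unfolding lebesgue_class_def by blast+
  have sets_\<mu>I: "Z \<in> sets \<mu>" if "Z \<in> sets borel" "Z \<subseteq> \<Theta>" for Z
    using that closed(2) by (simp add: sets(1) sets_restrict_space_iff)
  have fsigma: "fsigma_in euclidean R" if R: "openin (top_of_set Y) R" for R
  proof -
    obtain W where "open W" "R = Y \<inter> W" using R unfolding openin_open by blast
    then show ?thesis
      using closed(1) by (simp add: fsigma_in_Int closed_imp_fsigma_in open_imp_fsigma_in_euclidean)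
  qed
  have contg: "continuous_on P g" by (rule locally_Lipschitz_on_imp_continuous_on[OF g(1)])
  define R where "R = P \<inter> regular_points m Y \<inter> {y\<in>P. g y \<in> regular_points m \<Theta>}"
  have R_open: "openin (top_of_set Y) R"
    unfolding R_def
    by (intro openin_Int P openin_regular_points openin_preimage_trans[OF P contg g(2) openin_regular_points])
  have "\<forall>y\<in>R. \<exists>\<delta>>0. Y \<inter> cball y \<delta> \<subseteq> P \<and> lebesgue_null m \<Theta> {\<theta>. infinite {z \<in> Y \<inter> cball y \<delta>. g z = \<theta>}}"
  proof
    fix y assume "y \<in> R"
    then have "y \<in> P" "y \<in> regular_points m Y" "g y \<in> regular_points m \<Theta>" by (auto simp: R_def)
    from locally_finite_fibers[OF closed(1) P g this]
    show "\<exists>\<delta>>0. Y \<inter> cball y \<delta> \<subseteq> P \<and> lebesgue_null m \<Theta> {\<theta>. infinite {z \<in> Y \<inter> cball y \<delta>. g z = \<theta>}}"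
      by metis
  qed
  from bchoice[OF this] obtain \<delta> where \<delta>: "\<forall>y\<in>R. \<delta> y > 0 \<and> Y \<inter> cball y (\<delta> y) \<subseteq> P \<and>
      lebesgue_null m \<Theta> {\<theta>. infinite {z \<in> Y \<inter> cball y (\<delta> y). g z = \<theta>}}" by blast
  obtain \<U> where \<U>: "\<U> \<subseteq> (\<lambda>y. ball y (\<delta> y)) ` R" "countable \<U>" "\<Union>\<U> = \<Union>((\<lambda>y. ball y (\<delta> y)) ` R)"
  proof (rule Lindelof_openin[of "(\<lambda>y. ball y (\<delta> y)) ` R" UNIV])
    show "openin (top_of_set UNIV) S" if "S \<in> (\<lambda>y. ball y (\<delta> y)) ` R" for S using that by auto
  qed
  from countable_subset_image[THEN iffD1, OF conjI[OF \<U>(2,1)]]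
  obtain C where C: "countable C" "C \<subseteq> R" "\<U> = (\<lambda>y. ball y (\<delta> y)) ` C" by metis
  define \<K> where "\<K> = insert (P - R) ((\<lambda>y. Y \<inter> cball y (\<delta> y)) ` C)"
  have null_g: "lebesgue_null m \<Theta> (g ` N)" if "lebesgue_null m Y N" "N \<subseteq> P" for N
    using that openin_imp_subset[OF P]
    by (intro lebesgue_null_image[OF Y] locally_Lipschitz_on_subset[OF g(1)]) auto
  have bad: "P - R \<subseteq> P \<and> fsigma_in euclidean (P - R) \<and> (AE \<theta> in \<mu>. finite {y\<in>P - R. g y = \<theta>})"
  proof (intro conjI)
    obtain W where W: "open W" "R = Y \<inter> W" using R_open unfolding openin_open by blast
    then have "P - R = P \<inter> (Y - W)" using openin_imp_subset[OF P] by auto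
    then show fs: "fsigma_in euclidean (P - R)"
      using W(1) closed(1) by (simp add: fsigma_in_Int fsigma[OF P] closed_imp_fsigma_in closed_Diff)
    \<comment> \<open>A point of \<open>P - R\<close> with regular image must itself be singular in
      \<open>Y\<close>, so charts of \<Theta> see only the image of \<open>?S\<close>.\<close>
    let ?S = "P - regular_points m Y"
    have "lebesgue_null m \<Theta> (g ` ?S)" by (intro null_g lebesgue_null_singular) auto
    then have null: "lebesgue_null m \<Theta> (g ` (P - R))"
      by (rule lebesgue_null_subset) (auto simp: R_def)
    have "g ` (P - R) \<in> sets \<mu>"
      by (intro sets_\<mu>I fsigma_in_borel fsigma_in_image fs continuous_on_subset[OF contg]) (use g(2) in auto)
    then have "g ` (P - R) \<in> null_sets \<mu>" using lebesgue_class_null_sets_iff[OF \<mu>] null by blast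
    then have "AE \<theta> in \<mu>. \<theta> \<notin> g ` (P - R)" by (rule AE_not_in)
    then show "AE \<theta> in \<mu>. finite {y\<in>P - R. g y = \<theta>}"
    proof eventually_elim
      fix \<theta> assume "\<theta> \<notin> g ` (P - R)"
      then have "{y\<in>P - R. g y = \<theta>} = {}" by blast
      then show "finite {y\<in>P - R. g y = \<theta>}" by (simp only: finite.emptyI)
    qed
  qed blast
  have good: "K \<subseteq> P \<and> fsigma_in euclidean K \<and> (AE \<theta> in \<mu>. finite {y\<in>K. g y = \<theta>})"
    if y: "y \<in> C" and K_def: "K = Y \<inter> cball y (\<delta> y)" for y K
  proof (intro conjI)
    have "y \<in> R" using y C(2) by blast
    then have KP: "K \<subseteq> P" and null: "lebesgue_null m \<Theta> {\<theta>. infinite {z\<in>K. g z = \<theta>}}"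
      using \<delta> unfolding K_def by blast+
    show "K \<subseteq> P" by (rule KP)
    have "closed K" unfolding K_def using closed(1) by auto
    then show fs: "fsigma_in euclidean K" by (intro closed_imp_fsigma_in) simp
    \<comment> \<open>The set of values with infinite fibers must be measurable before
      \<open>lebesgue_class\<close> gives it measure zero; it is where this Borel count is
      infinite.\<close>
    have "fiber_sum K g (indicator K) \<in> borel_measurable borel"
    proof (rule borel_measurable_fiber_sum[OF continuous_on_subset[OF contg KP]])
      fix t :: ennreal
      have "{y\<in>K. t < indicator K y} = (if t < 1 then K else {})" by auto
      then show "fsigma_in euclidean {y\<in>K. t < indicator K y}" using fs by (simp split: if_splits)
    qed
    then have "{\<theta>\<in>space borel. fiber_sum K g (indicator K) \<theta> = \<infinity>} \<in> sets borel" by measurable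
    moreover have "fiber_sum K g (indicator K) \<theta> = \<infinity> \<longleftrightarrow> infinite {z\<in>K. g z = \<theta>}" for \<theta>
      by (cases "finite {z\<in>K. g z = \<theta>}") (simp_all add: fiber_sum_indicator[OF subset_refl])
    ultimately have "{\<theta>. infinite {z\<in>K. g z = \<theta>}} \<in> sets borel" by simp
    moreover have "{\<theta>. infinite {z\<in>K. g z = \<theta>}} \<subseteq> \<Theta>"
    proof
      fix \<theta> assume "\<theta> \<in> {\<theta>. infinite {z\<in>K. g z = \<theta>}}"
      then have "{z\<in>K. g z = \<theta>} \<noteq> {}" by (metis (no_types, lifting) finite.emptyI mem_Collect_eq)
      then show "\<theta> \<in> \<Theta>" using KP g(2) by blast
    qed
    ultimately have "{\<theta>. infinite {z\<in>K. g z = \<theta>}} \<in> null_sets \<mu>"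
      using sets_\<mu>I lebesgue_class_null_sets_iff[OF \<mu>] null by blast
    from AE_not_in[OF this] show "AE \<theta> in \<mu>. finite {y\<in>K. g y = \<theta>}" by simp
  qed
  have "fiber_counting \<mu> \<nu> \<Theta> Y P g \<K>"
  proof (intro fiber_counting.intro fiber_counting_axioms.intro)
    show "finite_measure \<mu>" "finite_measure \<nu>" by fact+
    show "sets \<mu> = sets (restrict_space borel \<Theta>)" "sets \<nu> = sets (restrict_space borel Y)" by fact+
    show "closed Y" "continuous_on P g" "g ` P \<subseteq> \<Theta>" by fact+
    show "P \<subseteq> Y" by (rule openin_imp_subset[OF P])
    show "fsigma_in euclidean P" by (rule fsigma[OF P])
    show "Z \<in> null_sets \<mu>" if "N \<in> null_sets \<nu>" "N \<subseteq> P" "Z \<in> sets \<mu>" "Z \<subseteq> g ` N" for N Z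
    proof -
      have "lebesgue_null m Y N" using that(1) lebesgue_class_null_sets_iff[OF \<nu>] null_setsD2 by blast
      then have "lebesgue_null m \<Theta> (g ` N)" using that(2) by (rule null_g)
      then have "lebesgue_null m \<Theta> Z" by (rule lebesgue_null_subset) (use that(4) in blast)
      then show ?thesis using that(3) lebesgue_class_null_sets_iff[OF \<mu>] by blast
    qed
    show "countable \<K>" unfolding \<K>_def using C(1) by simp
    show "P \<subseteq> \<Union>\<K>"
    proof
      fix x assume x: "x \<in> P"
      show "x \<in> \<Union>\<K>"
      proof (cases "x \<in> R")
        case True
        then have "x \<in> \<Union>((\<lambda>y. ball y (\<delta> y)) ` R)" using \<delta> by force
        then have "x \<in> \<Union>((\<lambda>y. ball y (\<delta> y)) ` C)" unfolding \<U>(3)[symmetric] C(3) .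
        then obtain y where "y \<in> C" "x \<in> ball y (\<delta> y)" by blast
        moreover then have "x \<in> Y \<inter> cball y (\<delta> y)" using x openin_imp_subset[OF P] by auto
        ultimately show ?thesis unfolding \<K>_def by blast
      qed (use x in \<open>auto simp: \<K>_def\<close>)
    qed
    show "K \<subseteq> P \<and> fsigma_in euclidean K \<and> (AE \<theta> in \<mu>. finite {y\<in>K. g y = \<theta>})" if "K \<in> \<K>" for K
      using that bad good unfolding \<K>_def by blast
  qed
  then show ?thesis by blast
qed

section \<open>Iterates of piecewise diffeomorphisms\<close>

lemma piecewise_diffeo_sym:
  assumes "piecewise_diffeo X T \<Sigma> T' \<Sigma>'"
  shows "piecewise_diffeo X T' \<Sigma>' T \<Sigma>"
proof -
  have "homeomorphism (X - \<Sigma>') (X - \<Sigma>) T' T"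
    by (rule homeomorphism_symD) (use assms in \<open>simp add: piecewise_diffeo_def diffeomorphism_def\<close>)
  then show ?thesis using assms unfolding piecewise_diffeo_def diffeomorphism_def by simp
qed

lemma regular_iterate_dom_Suc:
  "regular_iterate_dom X T \<Sigma> (Suc k) = {x \<in> regular_iterate_dom X T \<Sigma> k. (T ^^ k) x \<in> X - \<Sigma>}"
  by (auto simp: regular_iterate_dom_def less_Suc_eq)

text \<open>Each further step only asks that the current iterate avoid the closed set
  \<open>\<Sigma>\<close>, a relatively open condition, and locally Lipschitz maps compose.\<close>

lemma regular_iterate:
  assumes "piecewise_diffeo X T \<Sigma> T' \<Sigma>'"
  shows "openin (top_of_set X) (regular_iterate_dom X T \<Sigma> k) \<and>
    locally_Lipschitz_on (regular_iterate_dom X T \<Sigma> k) (T ^^ k) \<and>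
    (T ^^ k) ` regular_iterate_dom X T \<Sigma> k \<subseteq> X"
proof (induction k)
  case 0
  have "locally_Lipschitz_on X (\<lambda>x. x)"
    by (rule bounded_linear_imp_locally_Lipschitz_on[OF bounded_linear_ident])
  then show ?case by (simp add: regular_iterate_dom_def id_def)
next
  case (Suc k)
  let ?D = "regular_iterate_dom X T \<Sigma> k"
  have hom: "homeomorphism (X - \<Sigma>) (X - \<Sigma>') T T'" and T: "locally_Lipschitz_on (X - \<Sigma>) T"
    using assms C1_on_imp_locally_Lipschitz_on unfolding piecewise_diffeo_def diffeomorphism_def by blast+
  have "closed \<Sigma>" using assms unfolding piecewise_diffeo_def by blast
  then have "openin (top_of_set X) (X - \<Sigma>)" by (metis Diff_eq openin_open_Int open_Compl)
  with Suc have "openin (top_of_set X) {x \<in> ?D. (T ^^ k) x \<in> X - \<Sigma>}"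
    using locally_Lipschitz_on_imp_continuous_on by (intro openin_preimage_trans[where Q=X]) auto
  moreover have "locally_Lipschitz_on {x \<in> ?D. (T ^^ k) x \<in> X - \<Sigma>} (\<lambda>x. T ((T ^^ k) x))"
    by (rule locally_Lipschitz_on_compose[OF locally_Lipschitz_on_subset[of ?D] T]) (use Suc in auto)
  moreover have "T ` (X - \<Sigma>) \<subseteq> X" using homeomorphism_image1[OF hom] by blast
  ultimately show ?case
    unfolding regular_iterate_dom_Suc by (auto simp: o_def)
qed

text \<open>The forward orbit of \<open>(T' ^^ k) y\<close> retraces the backward orbit of
  \<open>y\<close>, and \<open>T'\<close> sends points off \<open>\<Sigma>'\<close> to points off
  \<open>\<Sigma>\<close>.\<close>

lemma regular_iterate_inverse:
  assumes pd: "piecewise_diffeo X T \<Sigma> T' \<Sigma>'" and "y \<in> regular_iterate_dom X T' \<Sigma>' k"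
  shows "(T' ^^ k) y \<in> regular_iterate_dom X T \<Sigma> k \<and> (T ^^ k) ((T' ^^ k) y) = y"
  using assms(2)
proof (induction k)
  case 0
  then show ?case by (simp add: regular_iterate_dom_def)
next
  case (Suc k)
  have hom: "homeomorphism (X - \<Sigma>) (X - \<Sigma>') T T'"
    using pd unfolding piecewise_diffeo_def diffeomorphism_def by blast
  define z where "z = (T' ^^ k) y"
  have y: "y \<in> regular_iterate_dom X T' \<Sigma>' k" and z: "z \<in> X - \<Sigma>'"
    using Suc.prems unfolding regular_iterate_dom_Suc z_def by auto
  have T'z: "T' z \<in> X - \<Sigma>" using homeomorphism_image2[OF hom] z by blast
  have TT': "T (T' z) = z" using homeomorphism_apply2[OF hom] z by blast
  have IH: "z \<in> regular_iterate_dom X T \<Sigma> k" "(T ^^ k) z = y"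
    using Suc.IH[OF y] by (auto simp: z_def)
  \<comment> \<open>For \<open>i = 0\<close> this is \<open>T'z\<close>; a positive \<open>i\<close>
    reduces to the iterate \<open>i - 1\<close> of \<open>z\<close>, because
    \<open>T (T' z) = z\<close>.\<close>
  have "(T ^^ i) (T' z) \<in> X - \<Sigma>" if "i < Suc k" for i
    using that T'z TT' IH(1) by (cases i) (auto simp: funpow_swap1 regular_iterate_dom_def)
  then show ?case
    using T'z TT' IH(2) by (simp add: regular_iterate_dom_def funpow_swap1 flip: z_def)
qed

lemma bij_betw_iterate_preimage:
  assumes pd: "piecewise_diffeo X T \<Sigma> T' \<Sigma>'"
  shows "bij_betw (T' ^^ k) (Y \<inter> regular_iterate_dom X T' \<Sigma>' k) (iterate_preimage X T \<Sigma> k Y)"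
proof (rule bij_betw_byWitness[where f'="T ^^ k"])
  note inv = regular_iterate_inverse[OF pd] and inv' = regular_iterate_inverse[OF piecewise_diffeo_sym[OF pd]]
  show "\<forall>y\<in>Y \<inter> regular_iterate_dom X T' \<Sigma>' k. (T ^^ k) ((T' ^^ k) y) = y" using inv by blast
  show "\<forall>x\<in>iterate_preimage X T \<Sigma> k Y. (T' ^^ k) ((T ^^ k) x) = x"
    using inv' by (auto simp: iterate_preimage_def)
  show "(T' ^^ k) ` (Y \<inter> regular_iterate_dom X T' \<Sigma>' k) \<subseteq> iterate_preimage X T \<Sigma> k Y"
    using inv by (auto simp: iterate_preimage_def)
  show "(T ^^ k) ` iterate_preimage X T \<Sigma> k Y \<subseteq> Y \<inter> regular_iterate_dom X T' \<Sigma>' k"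
    using inv' by (auto simp: iterate_preimage_def)
qed

text \<open>Tonelli for counting measures separates the times; at each \<open>k\<close> the sum is
  reindexed by the bijection \<open>T' ^^ k\<close>.\<close>

lemma weighted_count_eq_suminf:
  assumes pd: "piecewise_diffeo X T \<Sigma> T' \<Sigma>'"
  shows "weighted_count X T \<Sigma> Y \<eta> w \<theta> =
    (\<Sum>k. fiber_sum (Y \<inter> regular_iterate_dom X T' \<Sigma>' k) (\<lambda>y. \<eta> ((T' ^^ k) y))
      (\<lambda>y. ennreal (w ((T' ^^ k) y, k))) \<theta>)"
proof -
  let ?P = "\<lambda>k. Y \<inter> regular_iterate_dom X T' \<Sigma>' k"
  let ?F = "\<lambda>k. {y\<in>?P k. \<eta> ((T' ^^ k) y) = \<theta>}"
  let ?G = "Gamma X T \<Sigma> Y \<eta> \<theta>"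
  have "weighted_count X T \<Sigma> Y \<eta> w \<theta> = (\<integral>\<^sup>+z. ennreal (w z) * indicator ?G z \<partial>count_space UNIV)"
    unfolding weighted_count_def infsum_ennreal_eq_nn_integral
    by (subst nn_integral_count_space_indicator) (auto simp: case_prod_beta)
  also have "\<dots> = (\<integral>\<^sup>+k. \<integral>\<^sup>+x. ennreal (w (x, k)) * indicator ?G (x, k) \<partial>count_space UNIV \<partial>count_space UNIV)"
    by (rule nn_integral_snd_count_space[symmetric])
  also have "\<dots> = (\<Sum>k. \<integral>\<^sup>+x. ennreal (w (x, k)) * indicator ?G (x, k) \<partial>count_space UNIV)"
    by (rule nn_integral_count_space_nat)
  also have "\<dots> = (\<Sum>k. fiber_sum (?P k) (\<lambda>y. \<eta> ((T' ^^ k) y)) (\<lambda>y. ennreal (w ((T' ^^ k) y, k))) \<theta>)"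
  proof (rule suminf_cong)
    fix k
    let ?Q = "{x\<in>iterate_preimage X T \<Sigma> k Y. \<eta> x = \<theta>}"
    note bij = bij_betw_iterate_preimage[OF pd, of k Y]
    have "(T' ^^ k) ` ?F k = ?Q" using bij_betw_imp_surj_on[OF bij] by (auto simp: image_iff)
    then have "bij_betw (T' ^^ k) (?F k) ?Q" using bij_betw_subset[OF bij, of "?F k"] by blast
    then have "fiber_sum (?P k) (\<lambda>y. \<eta> ((T' ^^ k) y)) (\<lambda>y. ennreal (w ((T' ^^ k) y, k))) \<theta>
      = (\<integral>\<^sup>+x. ennreal (w (x, k)) \<partial>count_space ?Q)"
      unfolding fiber_sum_def by (rule nn_integral_bij_count_space)
    also have "\<dots> = (\<integral>\<^sup>+x. ennreal (w (x, k)) * indicator ?Q x \<partial>count_space UNIV)"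
      by (rule nn_integral_count_space_indicator) simp
    also have "\<dots> = (\<integral>\<^sup>+x. ennreal (w (x, k)) * indicator ?G (x, k) \<partial>count_space UNIV)"
      by (intro nn_integral_cong)
         (auto simp: Gamma_def fiber_def iterate_preimage_def regular_iterate_dom_def split: split_indicator)
    finally show "(\<integral>\<^sup>+x. ennreal (w (x, k)) * indicator ?G (x, k) \<partial>count_space UNIV)
      = fiber_sum (?P k) (\<lambda>y. \<eta> ((T' ^^ k) y)) (\<lambda>y. ennreal (w ((T' ^^ k) y, k))) \<theta>" ..
  qed
  finally show ?thesis .
qed

section \<open>Summation over all times\<close>

theorem proposition1:
  fixes X Y \<Sigma> \<Sigma>' :: "'a::euclidean_space set"
    and \<Theta> :: "'b::euclidean_space set"
    and T T' :: "'a \<Rightarrow> 'a"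
    and \<eta> :: "'a \<Rightarrow> 'b"
    and n m :: nat
    and \<mu> :: "'b measure" and \<nu> :: "'a measure"
  assumes "compact_manifold n X"
    and "piecewise_diffeo X T \<Sigma> T' \<Sigma>'"
    and "fibration n X m \<Theta> \<eta>"
    and "Y \<subseteq> X" and "closed Y" and "compact_manifold m Y"
    and "\<And>k \<theta>. \<theta> \<in> \<Theta> \<Longrightarrow>
           transversal n X m (iterate_preimage X T \<Sigma> k Y) (n - m) (fiber X \<eta> \<theta>)"
    and "finite_measure \<mu>" and "lebesgue_class m \<Theta> \<mu>"
    and "finite_measure \<nu>" and "lebesgue_class m Y \<nu>"
  shows "\<exists>r :: nat \<Rightarrow> 'a \<Rightarrow> real.
           (\<forall>k. r k \<in> borel_measurable \<nu> \<and> (\<forall>y\<in>Y. r k y \<ge> 0)) \<and>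
           (\<forall>w :: 'a \<times> nat \<Rightarrow> real.
              continuous_on (X \<times> UNIV) w \<and> (\<forall>x\<in>X. \<forall>k. w (x, k) \<ge> 0) \<longrightarrow>
              weighted_count X T \<Sigma> Y \<eta> w \<in> borel_measurable \<mu> \<and>
              (\<integral>\<^sup>+ \<theta>. weighted_count X T \<Sigma> Y \<eta> w \<theta> \<partial>\<mu>) =
              (\<integral>\<^sup>+ y. (\<Sum>\<^sub>\<infinity>k\<in>{k. y \<in> regular_iterate_dom X T' \<Sigma>' k}.
                         ennreal (w ((T' ^^ k) y, k) * r k y)) \<partial>\<nu>))"
proof -
  note pd = assms(2)
  have \<Theta>: "compact_manifold m \<Theta>" and \<eta>: "locally_Lipschitz_on X \<eta>" "\<eta> ` X = \<Theta>"
    using assms(3) C1_on_imp_locally_Lipschitz_on unfolding fibration_def by blast+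
  define P where "P k = Y \<inter> regular_iterate_dom X T' \<Sigma>' k" for k
  define g where "g k y = \<eta> ((T' ^^ k) y)" for k y
  note reg = regular_iterate[OF piecewise_diffeo_sym[OF pd]]
  have lipT': "locally_Lipschitz_on (P k) (T' ^^ k)" and imT': "(T' ^^ k) ` P k \<subseteq> X" for k
    using reg[of k] locally_Lipschitz_on_subset[of _ "T' ^^ k" "P k"] unfolding P_def by auto
  have P_open: "openin (top_of_set Y) (P k)" for k
    using reg[of k] \<open>Y \<subseteq> X\<close> unfolding P_def by (metis openin_subtopology_Int2 subtopology_subtopology Int_absorb1 Int_commute)
  have "\<exists>\<K>. fiber_counting \<mu> \<nu> \<Theta> Y (P k) (g k) \<K>" for k
  proof (rule exists_fiber_counting[OF assms(6) \<Theta> assms(8-11) P_open])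
    show "locally_Lipschitz_on (P k) (g k)"
      unfolding g_def by (rule locally_Lipschitz_on_compose[OF lipT' \<eta>(1) imT'])
    show "g k ` P k \<subseteq> \<Theta>" using imT'[of k] \<eta>(2) by (auto simp: g_def)
  qed
  then obtain \<K> where fc: "\<And>k. fiber_counting \<mu> \<nu> \<Theta> Y (P k) (g k) (\<K> k)" by metis
  \<comment> \<open>The densities are chosen here, before any weight is introduced, so one family
    serves all weights.\<close>
  have "\<exists>r. r \<in> borel_measurable \<nu> \<and> (\<forall>y. r y \<ge> 0) \<and> (\<forall>h\<in>borel_measurable \<nu>.
      (\<integral>\<^sup>+\<theta>. fiber_sum (P k) (g k) h \<theta> \<partial>\<mu>) = (\<integral>\<^sup>+y. h y * ennreal (r y) \<partial>\<nu>))
      \<and> (\<forall>y. y \<notin> P k \<longrightarrow> r y = 0)" for k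
    by (rule fiber_counting.fiber_density[OF fc[of k]]) blast
  then obtain r :: "nat \<Rightarrow> 'a \<Rightarrow> real" where r: "\<And>k. r k \<in> borel_measurable \<nu>" "\<And>k y. r k y \<ge> 0"
    "\<And>k h. h \<in> borel_measurable \<nu> \<Longrightarrow> (\<integral>\<^sup>+\<theta>. fiber_sum (P k) (g k) h \<theta> \<partial>\<mu>) = (\<integral>\<^sup>+y. h y * ennreal (r k y) \<partial>\<nu>)"
    "\<And>k y. y \<notin> P k \<Longrightarrow> r k y = 0" by metis
  show ?thesis
  proof (intro exI[of _ r] conjI allI impI ballI)
    fix w :: "'a \<times> nat \<Rightarrow> real"
    assume "continuous_on (X \<times> UNIV) w \<and> (\<forall>x\<in>X. \<forall>k. w (x, k) \<ge> 0)"
    then have w: "continuous_on (X \<times> UNIV) w" "\<And>x k. x \<in> X \<Longrightarrow> w (x, k) \<ge> 0" by auto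
    \<comment> \<open>The indicator removes points where the iterate of \<open>T'\<close> is not
      regular; there its value is arbitrary and \<open>w\<close> may be evaluated outside its domain
      of continuity.\<close>
    define h where "h k y = indicator (P k) y * w ((T' ^^ k) y, k)" for k y
    have cont: "continuous_on (P k) (\<lambda>y. w ((T' ^^ k) y, k))" for k
      by (rule continuous_on_compose2[OF w(1)])
         (use imT'[of k] locally_Lipschitz_on_imp_continuous_on[OF lipT'] in \<open>auto intro!: continuous_intros\<close>)
    have sum_eq: "weighted_count X T \<Sigma> Y \<eta> w \<theta> = (\<Sum>k. fiber_sum (P k) (g k) (\<lambda>y. ennreal (h k y)) \<theta>)" for \<theta>
      unfolding weighted_count_eq_suminf[OF pd] P_def[symmetric] g_def
      by (intro suminf_cong fiber_sum_cong) (simp add: h_def)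
    have meas: "fiber_sum (P k) (g k) (\<lambda>y. ennreal (h k y)) \<in> borel_measurable \<mu>" for k
    proof -
      interpret fiber_counting \<mu> \<nu> \<Theta> Y "P k" "g k" "\<K> k" by (rule fc)
      show ?thesis
      proof (intro borel_measurable_\<mu>I borel_measurable_fiber_sum f(1))
        fix t :: ennreal
        have "continuous_on (P k) (\<lambda>y. ennreal (w ((T' ^^ k) y, k)))"
          using cont by (rule continuous_on_ennreal)
        \<comment> \<open>Superlevel sets of the weight are relatively open in the F-sigma set
          \<open>P k\<close>, hence F-sigma, as measurability of fiber sums requires.\<close>
        then have "openin (top_of_set (P k)) (P k \<inter> (\<lambda>y. ennreal (w ((T' ^^ k) y, k))) -` {t<..})"
          by (rule continuous_openin_preimage_gen) simp
        then obtain W where "open W" "P k \<inter> (\<lambda>y. ennreal (w ((T' ^^ k) y, k))) -` {t<..} = P k \<inter> W"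
          unfolding openin_open by blast
        moreover have "{y\<in>P k. t < ennreal (h k y)} = P k \<inter> (\<lambda>y. ennreal (w ((T' ^^ k) y, k))) -` {t<..}"
          by (auto simp: h_def)
        ultimately show "fsigma_in euclidean {y\<in>P k. t < ennreal (h k y)}"
          using P(2) by (simp add: fsigma_in_Int open_imp_fsigma_in_euclidean)
      qed
    qed
    show "weighted_count X T \<Sigma> Y \<eta> w \<in> borel_measurable \<mu>"
      unfolding sum_eq[abs_def] using meas by measurable
    have h_meas: "(\<lambda>y. ennreal (h k y)) \<in> borel_measurable \<nu>" for k
    proof -
      interpret fiber_counting \<mu> \<nu> \<Theta> Y "P k" "g k" "\<K> k" by (rule fc)
      have "P k \<in> sets borel" using fsigma_in_borel[OF P(2)] .
      then have "(\<lambda>y. indicator (P k) y *\<^sub>R w ((T' ^^ k) y, k)) \<in> borel_measurable borel"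
        using cont by (rule borel_measurable_continuous_on_indicator)
      then have "(\<lambda>y. ennreal (h k y)) \<in> borel_measurable borel" unfolding h_def by simp
      then show ?thesis
        unfolding measurable_cong_sets[OF sets_\<nu> refl] by (rule measurable_restrict_space1)
    qed
    have "(\<integral>\<^sup>+\<theta>. weighted_count X T \<Sigma> Y \<eta> w \<theta> \<partial>\<mu>)
        = (\<Sum>k. \<integral>\<^sup>+\<theta>. fiber_sum (P k) (g k) (\<lambda>y. ennreal (h k y)) \<theta> \<partial>\<mu>)"
      unfolding sum_eq by (rule nn_integral_suminf) (rule meas)
    also have "\<dots> = (\<Sum>k. \<integral>\<^sup>+y. ennreal (h k y) * ennreal (r k y) \<partial>\<nu>)"
      by (intro suminf_cong r(3) h_meas)
    also have "\<dots> = (\<integral>\<^sup>+y. (\<Sum>k. ennreal (h k y) * ennreal (r k y)) \<partial>\<nu>)"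
      by (rule nn_integral_suminf[symmetric]) (use h_meas r(1) in measurable)
    also have "\<dots> = (\<integral>\<^sup>+ y. (\<Sum>\<^sub>\<infinity>k\<in>{k. y \<in> regular_iterate_dom X T' \<Sigma>' k}.
                         ennreal (w ((T' ^^ k) y, k) * r k y)) \<partial>\<nu>)"
    proof (rule nn_integral_cong)
      fix y assume "y \<in> space \<nu>"
      moreover have "space \<nu> = Y"
        using assms(11) sets_eq_imp_space_eq[of \<nu> "restrict_space borel Y"]
        by (simp add: lebesgue_class_def space_restrict_space)
      ultimately have y: "y \<in> Y" by simp
      let ?D = "{k. y \<in> regular_iterate_dom X T' \<Sigma>' k}"
      have "(\<Sum>\<^sub>\<infinity>k\<in>?D. ennreal (w ((T' ^^ k) y, k) * r k y))
        = (\<integral>\<^sup>+k. ennreal (w ((T' ^^ k) y, k) * r k y) * indicator ?D k \<partial>count_space UNIV)"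
        unfolding infsum_ennreal_eq_nn_integral by (rule nn_integral_count_space_indicator) simp
      also have "\<dots> = (\<Sum>k. ennreal (w ((T' ^^ k) y, k) * r k y) * indicator ?D k)"
        by (rule nn_integral_count_space_nat)
      also have "\<dots> = (\<Sum>k. ennreal (h k y) * ennreal (r k y))"
      proof (rule suminf_cong)
        fix k
        show "ennreal (w ((T' ^^ k) y, k) * r k y) * indicator ?D k = ennreal (h k y) * ennreal (r k y)"
        proof (cases "k \<in> ?D")
          case True
          then have "y \<in> P k" using y by (simp add: P_def)
          \<comment> \<open>Nonnegativity of both factors allows \<open>ennreal\<close> to be
            distributed over the product.\<close>
          then have "w ((T' ^^ k) y, k) \<ge> 0" using imT'[of k] w(2) by blast
          then show ?thesis using True \<open>y \<in> P k\<close> r(2) by (simp add: h_def ennreal_mult)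
        next
          case False
          then have "y \<notin> P k" by (simp add: P_def)
          then show ?thesis using False by (simp add: h_def)
        qed
      qed
      finally show "(\<Sum>k. ennreal (h k y) * ennreal (r k y))
        = (\<Sum>\<^sub>\<infinity>k\<in>?D. ennreal (w ((T' ^^ k) y, k) * r k y))" ..
    qed
    finally show "(\<integral>\<^sup>+\<theta>. weighted_count X T \<Sigma> Y \<eta> w \<theta> \<partial>\<mu>) =
      (\<integral>\<^sup>+ y. (\<Sum>\<^sub>\<infinity>k\<in>{k. y \<in> regular_iterate_dom X T' \<Sigma>' k}.
                         ennreal (w ((T' ^^ k) y, k) * r k y)) \<partial>\<nu>)" .
  qed (use r in auto)
qed

end
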